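(* Let $F(t,x)$ be a scalar or vector-valued function for $t\in[0,T]$, $T>0$, and $x\in\Omega\subset\mathbb R^3$. Assume that $F_t(0,\cdot)\in L^3(\Omega)$, $F\in L^\infty([0,T];L^6(\Omega))$ and $F_{tt}\in L^\infty([0,T];L^2(\Omega))$. Then $$\|F_t\|_{L^3([0,T]\times\Omega)}^2\leq CT^{2/3}\Big[\|F_t(0)\|_{L^3(\Omega)}^2+\sup_{[0,T]}\|F(t)\|_{L^6(\Omega)}\|F_{tt}(t)\|_{L^2(\Omega)}\Big],$$ where $C$ is a constant independent of $T$, $\Omega$ and $F$.
   Context: $F_t$ and $F_{tt}$ denote the first and second time derivatives of $F$.
   Formalization: The supremum of the product of the norms at equal times is replaced by the product of the suprema of the L^6 norm of F and the L^2 norm of F_tt; with the equal-time product the inequality fails, e.g. for F = f(t) with f f'' = 1, f(0) = ε, f'(0) = 0, ε → 0. *)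

theory Defs
  imports "HOL-Probability.Essential_Supremum"
begin

section \<open>Lebesgue spaces\<close>

text \<open>
  Elements of Lebesgue and Bochner spaces are represented by functions, and every notion below is
  insensitive to modification on null sets, except for the value at time 0 in
  \<open>initial_trace\<close>. Membership is a separate predicate because the Bochner integral, and
  hence \<open>Lp_norm\<close>, is 0 for functions that are not integrable.
\<close>

definition in_Lp :: "real \<Rightarrow> 'b measure \<Rightarrow> ('b \<Rightarrow> 'a::euclidean_space) \<Rightarrow> bool" where
  "in_Lp p M f \<longleftrightarrow> f \<in> borel_measurable M \<and> integrable M (\<lambda>x. norm (f x) powr p)"

definition Lp_norm :: "real \<Rightarrow> 'b measure \<Rightarrow> ('b \<Rightarrow> 'a::euclidean_space) \<Rightarrow> real" where
  "Lp_norm p M f = (\<integral>x. norm (f x) powr p \<partial>M) powr (1 / p)"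

abbreviation cylinder :: "real \<Rightarrow> (real ^ 3) set \<Rightarrow> (real \<times> (real ^ 3)) measure" where
  "cylinder T \<Omega> \<equiv> lebesgue_on {0..T} \<Otimes>\<^sub>M lebesgue_on \<Omega>"

text \<open>
  The space of \<open>L\<^sup>p(\<Omega>)\<close>-valued, essentially bounded functions on \<open>[0,T]\<close>. For finite \<open>p\<close>,
  strong measurability in time amounts to joint measurability of a representative.
\<close>

definition Linf_Lp_esssup ::
  "real \<Rightarrow> real \<Rightarrow> (real ^ 3) set \<Rightarrow> (real \<Rightarrow> real ^ 3 \<Rightarrow> 'a::euclidean_space) \<Rightarrow> ereal" where
  "Linf_Lp_esssup p T \<Omega> F =
     esssup (lebesgue_on {0..T}) (\<lambda>t. ereal (Lp_norm p (lebesgue_on \<Omega>) (F t)))"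

definition in_Linf_Lp ::
  "real \<Rightarrow> real \<Rightarrow> (real ^ 3) set \<Rightarrow> (real \<Rightarrow> real ^ 3 \<Rightarrow> 'a::euclidean_space) \<Rightarrow> bool" where
  "in_Linf_Lp p T \<Omega> F \<longleftrightarrow>
     case_prod F \<in> borel_measurable (cylinder T \<Omega>) \<and>
     (AE t in lebesgue_on {0..T}. in_Lp p (lebesgue_on \<Omega>) (F t)) \<and>
     Linf_Lp_esssup p T \<Omega> F < \<infinity>"

definition Linf_Lp_norm ::
  "real \<Rightarrow> real \<Rightarrow> (real ^ 3) set \<Rightarrow> (real \<Rightarrow> real ^ 3 \<Rightarrow> 'a::euclidean_space) \<Rightarrow> real" where
  "Linf_Lp_norm p T \<Omega> F = real_of_ereal (Linf_Lp_esssup p T \<Omega> F)"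

text \<open>
  In the estimate, the supremum over time applies to the norms of \<open>F\<close> and of its second derivative
  separately. With the supremum of the product of the norms at equal times, the estimate fails:
  take \<open>F(t,x) = f(t)\<close> where \<open>f f'' = 1\<close>, \<open>f(0) = \<epsilon>\<close>, \<open>f'(0) = 0\<close>, so that
  \<open>f'(t)\<^sup>2 = 2 log (f(t) / \<epsilon>)\<close>, which is unbounded as \<open>\<epsilon>\<close> tends to 0.
\<close>

section \<open>Weak time derivatives\<close>

definition test_function :: "real set \<Rightarrow> (real \<Rightarrow> real) \<Rightarrow> bool" where
  "test_function S \<phi> \<longleftrightarrow>
     (\<forall>n t. (deriv ^^ n) \<phi> differentiable (at t)) \<and>
     compact (closure {t. \<phi> t \<noteq> 0}) \<and> closure {t. \<phi> t \<noteq> 0} \<subseteq> S"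

text \<open>
  The weak derivative of a function of time with values in a space of functions on \<open>\<Omega>\<close>:
  \<open>\<integral>\<^sub>0\<^sup>T \<phi>' F dt = - \<integral>\<^sub>0\<^sup>T \<phi> G dt\<close> for every scalar test function \<open>\<phi>\<close>. This is an identity between
  functions on \<open>\<Omega>\<close>, so it holds almost everywhere and the exceptional set may depend on
  \<open>\<phi>\<close>. The integrability conditions only say that the integrals make sense.
\<close>

definition weak_time_deriv ::
  "real \<Rightarrow> (real ^ 3) set \<Rightarrow> (real \<Rightarrow> real ^ 3 \<Rightarrow> 'a::euclidean_space) \<Rightarrow>
     (real \<Rightarrow> real ^ 3 \<Rightarrow> 'a) \<Rightarrow> bool" where
  "weak_time_deriv T \<Omega> F G \<longleftrightarrow>
     case_prod F \<in> borel_measurable (cylinder T \<Omega>) \<and>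
     case_prod G \<in> borel_measurable (cylinder T \<Omega>) \<and>
     (\<forall>\<phi>. test_function {0<..<T} \<phi> \<longrightarrow>
        (AE x in lebesgue_on \<Omega>.
           integrable (lebesgue_on {0..T}) (\<lambda>t. deriv \<phi> t *\<^sub>R F t x) \<and>
           integrable (lebesgue_on {0..T}) (\<lambda>t. \<phi> t *\<^sub>R G t x) \<and>
           (\<integral>t. deriv \<phi> t *\<^sub>R F t x \<partial>lebesgue_on {0..T}) =
             - (\<integral>t. \<phi> t *\<^sub>R G t x \<partial>lebesgue_on {0..T})))"

text \<open>
  A function that has a weak time derivative is only determined up to null sets, but has a
  representative that is continuous in time. The following says that the representative \<open>G\<close> at
  hand carries, at time 0, the value of the continuous one.
\<close>

definition initial_trace ::
  "real \<Rightarrow> (real ^ 3) set \<Rightarrow> (real \<Rightarrow> real ^ 3 \<Rightarrow> 'a::euclidean_space) \<Rightarrow> bool" where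
  "initial_trace T \<Omega> G \<longleftrightarrow>
     (AE x in lebesgue_on \<Omega>.
        \<exists>g. (AE t in lebesgue_on {0..T}. g t = G t x) \<and> (g \<longlongrightarrow> G 0 x) (at_right 0))"

end

theory Submission
  imports Defs "HOL-Computational_Algebra.Polynomial"
begin

text \<open>
  The estimate is a Gagliardo--Nirenberg inequality in the time variable alone, applied at almost
  every point \<open>x\<close> of \<open>\<Omega>\<close> and then integrated over \<open>\<Omega>\<close>.

  Fix \<open>x\<close>, let \<open>f\<close> be the function \<open>F(\<cdot>, x)\<close> of time, \<open>w = f'\<close>, \<open>c = w 0\<close>, and put
  \<open>X = \<integral> |w|^3\<close>, \<open>\<alpha> = \<integral> |f|^6\<close>, \<open>B = \<integral> |w'|^2\<close> over \<open>[0, T]\<close>. Lemma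
  \<open>interpolation_on_interval\<close> shows that \<open>X \<le> 8 T |c|^3\<close> or \<open>X^4 \<le> 2^36 \<alpha> B^3\<close>. If the boundary
  terms were absent, this would be one integration by parts: \<open>|w|^3\<close> is the inner product of \<open>f'\<close>
  with \<open>|w| w\<close>, so \<open>X \<le> 2 \<integral> |f| |w| |w'| \<le> 2 \<alpha>^(1/6) X^(1/3) B^(1/2)\<close>. The boundary terms are at
  most \<open>2 M m^2\<close> with \<open>M = max |f|\<close> and \<open>m = max |w|\<close>. Unless \<open>m \<le> 2 |c|\<close>, which gives the first
  alternative, the function \<open>w\<close> at least doubles in size after time 0, and the chain rule for
  \<open>|w|^3\<close> gives \<open>m^5 \<le> 16 X B\<close>. In the same way the chain rule for \<open>|f|^6\<close> gives
  \<open>M^15 \<le> 2^15 \<alpha>^2 X\<close>, unless \<open>\<alpha>\<close> is so large, \<open>\<alpha> \<ge> X^2 T^5\<close>, that the crude bound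
  \<open>m^2 \<le> 4 T B\<close> already suffices. These bounds turn \<open>2 M m^2\<close> into \<open>\<alpha>^(2/15) B^(2/5) X^(7/15)\<close>
  times a constant, which is absorbed.

  To integrate over \<open>\<Omega>\<close> without the exponents, the second alternative is used in the linear form
  \<open>X \<le> 2^9 (\<alpha> / l^3 + l B)\<close> for every \<open>l > 0\<close>. Tonelli's theorem bounds the space integrals of
  \<open>\<alpha>\<close> and \<open>B\<close> by \<open>T\<close> times powers of the two norms in the statement, and optimising over \<open>l\<close> at the
  end (\<open>le_optimal_weight\<close>) restores the product of the norms.

  What remains is to see that almost every slice is as regular as assumed above. The weak time
  derivative holds for almost every \<open>x\<close> with an exceptional set that depends on the test
  function, so only countably many test functions may be used.
  Lemma \<open>weak_derivative_indefinite_integral\<close> shows that a family indexed by rational numbers is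
  enough to recover a function as the indefinite integral of its weak derivative.
  The slices \<open>w\<close> are then only absolutely continuous, and the calculus needed for them is derived
  from \<open>increment_le_integral_if_locally\<close>.
\<close>

section \<open>Chain rule and integration by parts for absolutely continuous functions\<close>

lemma le_at_0_if_le_right:
  fixes h :: "real \<Rightarrow> real"
  assumes "isCont h 0" "\<And>e. e > 0 \<Longrightarrow> S \<le> h e"
  shows "S \<le> h 0"
proof (rule tendsto_lowerbound[of h _ "at_right 0"])
  show "(h \<longlongrightarrow> h 0) (at_right 0)"
    using assms(1) unfolding isCont_def by (rule tendsto_within_subset) auto
  show "\<forall>\<^sub>F e in at_right 0. S \<le> h e"
    using assms(2) by (auto intro: eventually_mono[OF eventually_at_right_less[of 0]])
qed auto

lemma absolutely_integrable_continuous_scaleR: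
  fixes k :: "real \<Rightarrow> real" and g :: "real \<Rightarrow> 'a::euclidean_space"
  assumes "continuous_on {a..b} k" "g absolutely_integrable_on {a..b}"
  shows "(\<lambda>t. k t *\<^sub>R g t) absolutely_integrable_on {a..b}"
proof (rule absolutely_integrable_bounded_measurable_product[of "(*\<^sub>R)" k "{a..b}" g, OF _ _ _ _ assms(2)])
  show "bilinear ((*\<^sub>R) :: real \<Rightarrow> 'a \<Rightarrow> 'a)"
    by (simp add: bilinear_conv_bounded_bilinear bounded_bilinear_scaleR)
  show "k \<in> borel_measurable (lebesgue_on {a..b})"
    using assms(1) by (simp add: continuous_imp_measurable_on_sets_lebesgue)
  show "bounded (k ` {a..b})"
    using assms(1) compact_continuous_image compact_imp_bounded by blast
qed auto

lemma integrable_continuous_mult: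
  fixes k h :: "real \<Rightarrow> real"
  assumes "continuous_on {a..b} k" "h integrable_on {a..b}" "\<And>t. t \<in> {a..b} \<Longrightarrow> 0 \<le> h t"
  shows "(\<lambda>t. k t * h t) integrable_on {a..b}"
  using absolutely_integrable_continuous_scaleR[OF assms(1) nonnegative_absolutely_integrable_1[OF assms(2,3)]]
  by (simp add: absolutely_integrable_on_def)

text \<open>
  This replaces differentiation almost everywhere for absolutely continuous functions. A bound on
  increments over short intervals, correct up to a small multiple of a fixed integral, adds up
  along a fine partition of \<open>[a,b]\<close>, and the error disappears as \<open>e\<close> tends to 0.
\<close>

lemma increment_le_integral_if_locally:
  fixes \<Phi> :: "real \<Rightarrow> 'a::real_normed_vector" and h k :: "real \<Rightarrow> real"
  assumes "a \<le> b" and h: "h integrable_on {a..b}" and k: "k integrable_on {a..b}"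
    and loc: "\<And>e. e > 0 \<Longrightarrow> \<exists>d>0. \<forall>s t. a \<le> s \<and> s \<le> t \<and> t \<le> b \<and> t - s < d \<longrightarrow>
                norm (\<Phi> t - \<Phi> s) \<le> integral {s..t} h + e * integral {s..t} k"
  shows "norm (\<Phi> b - \<Phi> a) \<le> integral {a..b} h"
proof -
  have *: "norm (\<Phi> b - \<Phi> a) \<le> integral {a..b} h + e * integral {a..b} k" if e: "e > 0" for e
  proof -
    obtain d where d: "d > 0" "\<And>s t. a \<le> s \<Longrightarrow> s \<le> t \<Longrightarrow> t \<le> b \<Longrightarrow> t - s < d \<Longrightarrow>
                norm (\<Phi> t - \<Phi> s) \<le> integral {s..t} h + e * integral {s..t} k"
      using loc[OF e] by metis
    obtain N where N: "(b - a) / d < real N" using reals_Archimedean2 by blast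
    have "N > 0" using N assms(1) d(1)
      by (metis divide_nonneg_pos diff_ge_0_iff_ge gr0I not_less of_nat_0)
    define p where "p i = a + real i * ((b - a) / real N)" for i
    have p0: "p 0 = a" and pN: "p N = b" using \<open>N > 0\<close> by (auto simp: p_def)
    have step: "p (Suc i) - p i = (b - a) / real N" for i
      by (simp add: p_def algebra_simps add_divide_distrib diff_divide_distrib)
    have small: "(b - a) / real N < d"
      using N d(1) \<open>N > 0\<close> by (simp add: field_simps)
    have mono: "p i \<le> p (Suc i)" for i using step[of i] assms(1)
      by (metis diff_ge_0_iff_ge divide_nonneg_nonneg of_nat_0_le_iff)
    have le: "p i \<le> b" if "i \<le> N" for i
      using lift_Suc_mono_le[of p i N, OF mono that] pN by simp
    have ge: "a \<le> p i" for i
      using lift_Suc_mono_le[of p 0 i, OF mono] p0 by simp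
    have "norm (\<Phi> (p i) - \<Phi> a) \<le> integral {a..p i} h + e * integral {a..p i} k" if "i \<le> N" for i
      using that
    proof (induction i)
      case 0
      then show ?case by (simp add: p0)
    next
      case (Suc i)
      have hh: "integral {a..p i} u + integral {p i..p (Suc i)} u = integral {a..p (Suc i)} u"
        if "u integrable_on {a..b}" for u :: "real \<Rightarrow> real"
        by (rule Henstock_Kurzweil_Integration.integral_combine)
          (use ge mono le[OF Suc.prems] integrable_subinterval_real[OF that] in auto)
      have "norm (\<Phi> (p (Suc i)) - \<Phi> a) \<le> norm (\<Phi> (p (Suc i)) - \<Phi> (p i)) + norm (\<Phi> (p i) - \<Phi> a)"
        using norm_triangle_ineq[of "\<Phi> (p (Suc i)) - \<Phi> (p i)" "\<Phi> (p i) - \<Phi> a"] by simp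
      also have "\<dots> \<le> (integral {p i..p (Suc i)} h + e * integral {p i..p (Suc i)} k)
          + (integral {a..p i} h + e * integral {a..p i} k)"
        using d(2)[OF ge mono le[OF Suc.prems]] step[of i] small Suc by (intro add_mono) auto
      finally show ?case unfolding hh[OF h, symmetric] hh[OF k, symmetric] by (simp add: algebra_simps)
    qed
    from this[of N] show ?thesis by (simp add: pN)
  qed
  from le_at_0_if_le_right[of "\<lambda>e. integral {a..b} h + e * integral {a..b} k", OF _ *]
  show ?thesis by simp
qed

lemma uniform_continuity_on_interval:
  fixes f :: "real \<Rightarrow> 'a::real_normed_vector"
  assumes "continuous_on {a..b} f" "e > 0"
  shows "\<exists>d>0. \<forall>s t. s \<in> {a..b} \<longrightarrow> t \<in> {a..b} \<longrightarrow> \<bar>t - s\<bar> < d \<longrightarrow> norm (f t - f s) < e"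
  using compact_uniformly_continuous[OF assms(1) compact_Icc] assms(2)
  unfolding uniformly_continuous_on_def dist_norm by (metis real_norm_def)

lemma abs_power_diff_le:
  fixes x y :: real
  assumes "0 \<le> x" "0 \<le> y"
  shows "\<bar>x ^ Suc k - y ^ Suc k\<bar> \<le> real (Suc k) * max x y ^ k * \<bar>x - y\<bar>"
proof -
  have "\<bar>\<Sum>i<Suc k. y ^ (Suc k - Suc i) * x ^ i\<bar> \<le> (\<Sum>i<Suc k. max x y ^ k)"
  proof (rule order_trans[OF sum_abs], rule sum_mono)
    fix i assume "i \<in> {..<Suc k}"
    then have i: "i \<le> k" by auto
    have "y ^ (Suc k - Suc i) * x ^ i \<le> max x y ^ (k - i) * max x y ^ i"
      unfolding diff_Suc_Suc using assms by (intro mult_mono power_mono) auto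
    also have "\<dots> = max x y ^ k" using i by (simp flip: power_add)
    finally show "\<bar>y ^ (Suc k - Suc i) * x ^ i\<bar> \<le> max x y ^ k" using assms by simp
  qed
  then have "\<bar>x - y\<bar> * \<bar>\<Sum>i<Suc k. y ^ (Suc k - Suc i) * x ^ i\<bar> \<le> \<bar>x - y\<bar> * (real (Suc k) * max x y ^ k)"
    by (intro mult_left_mono) auto
  then show ?thesis
    by (simp only: power_diff_sumr2[of x "Suc k" y] abs_mult) (simp add: mult_ac)
qed

text \<open>
  The chain rule for \<open>|w|^(k+1)\<close>, as an inequality. The function \<open>\<gamma>\<close> stands for \<open>|w'|\<close>, of which
  only the bound \<open>inc\<close> on increments matters. On a short interval \<open>|w|^k\<close> is nearly constant, so the
  increment of the power is at most \<open>(k+1) (|w|^k + e) \<integral> \<gamma>\<close>.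
\<close>

lemma norm_power_increment_le:
  fixes w :: "real \<Rightarrow> 'a::real_normed_vector"
  assumes ab: "a \<le> b" and w: "continuous_on {a..b} w"
    and \<gamma>: "\<gamma> integrable_on {a..b}" "\<And>t. t \<in> {a..b} \<Longrightarrow> 0 \<le> \<gamma> t"
    and inc: "\<And>s t. a \<le> s \<Longrightarrow> s \<le> t \<Longrightarrow> t \<le> b \<Longrightarrow> norm (w t - w s) \<le> integral {s..t} \<gamma>"
  shows "\<bar>norm (w b) ^ Suc k - norm (w a) ^ Suc k\<bar>
           \<le> real (Suc k) * integral {a..b} (\<lambda>t. norm (w t) ^ k * \<gamma> t)"
proof -
  let ?h = "\<lambda>t. real (Suc k) * (norm (w t) ^ k * \<gamma> t)"
  have int: "(\<lambda>t. norm (w t) ^ k * \<gamma> t) integrable_on {a..b}"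
    by (intro integrable_continuous_mult \<gamma> continuous_intros w)
  have "norm (norm (w b) ^ Suc k - norm (w a) ^ Suc k) \<le> integral {a..b} ?h"
  proof (rule increment_le_integral_if_locally[OF ab, where k = "\<lambda>t. real (Suc k) * \<gamma> t"])
    show "?h integrable_on {a..b}" "(\<lambda>t. real (Suc k) * \<gamma> t) integrable_on {a..b}"
      using int \<gamma>(1) by (auto intro!: integrable_on_mult_right)
    fix e :: real assume "e > 0"
    moreover have "continuous_on {a..b} (\<lambda>t. norm (w t) ^ k)" by (intro continuous_intros w)
    ultimately obtain d where d: "d > 0" "\<And>s t. s \<in> {a..b} \<Longrightarrow> t \<in> {a..b} \<Longrightarrow> \<bar>t - s\<bar> < d
        \<Longrightarrow> norm (norm (w t) ^ k - norm (w s) ^ k) < e"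
      using uniform_continuity_on_interval by metis
    show "\<exists>d>0. \<forall>s t. a \<le> s \<and> s \<le> t \<and> t \<le> b \<and> t - s < d \<longrightarrow>
       norm (norm (w t) ^ Suc k - norm (w s) ^ Suc k)
          \<le> integral {s..t} ?h + e * integral {s..t} (\<lambda>t. real (Suc k) * \<gamma> t)"
    proof (intro exI conjI allI impI)
      fix s t assume st: "a \<le> s \<and> s \<le> t \<and> t \<le> b \<and> t - s < d"
      define m where "m = max (norm (w t)) (norm (w s)) ^ k"
      have sub: "u integrable_on {s..t}" if "u integrable_on {a..b}" for u :: "real \<Rightarrow> real"
        using integrable_subinterval_real[OF that] st by auto
      have m: "m \<le> norm (w r) ^ k + e" if "r \<in> {s..t}" for r
        using d(2)[of r t] d(2)[of r s] that st unfolding m_def max_def real_norm_def by (auto split: if_splits)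
      have "norm (norm (w t) ^ Suc k - norm (w s) ^ Suc k) \<le> real (Suc k) * m * \<bar>norm (w t) - norm (w s)\<bar>"
        unfolding m_def real_norm_def by (rule abs_power_diff_le) auto
      also have "\<dots> \<le> real (Suc k) * m * integral {s..t} \<gamma>"
        using inc[of s t] st norm_triangle_ineq3[of "w t" "w s"]
        by (intro mult_left_mono) (auto simp: m_def le_max_iff_disj intro!: mult_nonneg_nonneg zero_le_power)
      also have "\<dots> = integral {s..t} (\<lambda>t. real (Suc k) * m * \<gamma> t)" by simp
      also have "\<dots> \<le> integral {s..t} (\<lambda>t. ?h t + e * (real (Suc k) * \<gamma> t))"
      proof (rule integral_le)
        show "(\<lambda>t. real (Suc k) * m * \<gamma> t) integrable_on {s..t}"
          by (intro integrable_on_mult_right sub \<gamma>)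
        show "(\<lambda>t. ?h t + e * (real (Suc k) * \<gamma> t)) integrable_on {s..t}"
          by (intro integrable_add integrable_on_mult_right sub \<gamma> int)
        fix r assume r: "r \<in> {s..t}"
        have "real (Suc k) * m * \<gamma> r \<le> real (Suc k) * (norm (w r) ^ k + e) * \<gamma> r"
          using m[OF r] \<gamma>(2)[of r] r st by (intro mult_right_mono mult_left_mono) auto
        then show "real (Suc k) * m * \<gamma> r \<le> ?h r + e * (real (Suc k) * \<gamma> r)"
          by (simp add: algebra_simps)
      qed
      also have "\<dots> = integral {s..t} ?h + e * integral {s..t} (\<lambda>t. real (Suc k) * \<gamma> t)"
        by (subst Henstock_Kurzweil_Integration.integral_add)
          (auto intro!: integrable_on_mult_right sub \<gamma> int simp del: of_nat_Suc)
      finally show "norm (norm (w t) ^ Suc k - norm (w s) ^ Suc k)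
          \<le> integral {s..t} ?h + e * integral {s..t} (\<lambda>t. real (Suc k) * \<gamma> t)" .
    qed (use d in auto)
  qed
  then show ?thesis by simp
qed

lemma norm_scaleR_norm_diff_le:
  fixes x y :: "'a::real_normed_vector"
  shows "norm (norm x *\<^sub>R x - norm y *\<^sub>R y) \<le> (norm x + norm y) * norm (x - y)"
proof -
  have "norm x *\<^sub>R x - norm y *\<^sub>R y = norm x *\<^sub>R (x - y) + (norm x - norm y) *\<^sub>R y"
    by (simp add: algebra_simps)
  also have "norm \<dots> \<le> norm x * norm (x - y) + norm (x - y) * norm y"
    using norm_triangle_ineq3[of x y]
    by (intro order_trans[OF norm_triangle_ineq] add_mono) (auto intro: mult_right_mono)
  finally show ?thesis by (simp add: algebra_simps)
qed

text \<open>
  Integration by parts in \<open>\<integral> |w|^3 = \<integral> f' \<bullet> (|w| w)\<close>, where \<open>f' = w\<close>, together with the bound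
  \<open>2 |w| \<gamma>\<close> for the derivative of \<open>|w| w\<close>. Formally, the function \<open>\<Phi>\<close> below has derivative
  \<open>f \<bullet> (|w| w)'\<close>.
\<close>

lemma integral_norm_cube_le_by_parts:
  fixes f w :: "real \<Rightarrow> 'a::euclidean_space"
  assumes ab: "a \<le> b" and w: "continuous_on {a..b} w"
    and f: "\<And>s t. a \<le> s \<Longrightarrow> s \<le> t \<Longrightarrow> t \<le> b \<Longrightarrow> f t - f s = integral {s..t} w"
    and \<gamma>: "\<gamma> integrable_on {a..b}" "\<And>t. t \<in> {a..b} \<Longrightarrow> 0 \<le> \<gamma> t"
    and inc: "\<And>s t. a \<le> s \<Longrightarrow> s \<le> t \<Longrightarrow> t \<le> b \<Longrightarrow> norm (w t - w s) \<le> integral {s..t} \<gamma>"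
  shows "integral {a..b} (\<lambda>t. norm (w t) ^ 3) \<le> norm (f b) * norm (w b) ^ 2 + norm (f a) * norm (w a) ^ 2
           + 2 * integral {a..b} (\<lambda>t. norm (f t) * norm (w t) * \<gamma> t)"
proof -
  define P where "P x = norm x *\<^sub>R x" for x :: 'a
  define X where "X t = integral {a..t} (\<lambda>t. norm (w t) ^ 3)" for t
  define \<Phi> where "\<Phi> t = f t \<bullet> P (w t) - X t" for t
  have "continuous_on {a..b} (\<lambda>t. f a + integral {a..t} w)"
    by (intro continuous_intros indefinite_integral_continuous_1 integrable_continuous_real w)
  then have fc: "continuous_on {a..b} f"
    by (rule continuous_on_eq) (use f in \<open>force simp flip: f\<close>)
  let ?h = "\<lambda>t. 2 * (norm (f t) * norm (w t) * \<gamma> t)"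
  let ?k = "\<lambda>t. \<gamma> t + norm (w t)"
  have inth: "(\<lambda>t. norm (f t) * norm (w t) * \<gamma> t) integrable_on {a..b}"
    by (intro integrable_continuous_mult \<gamma> continuous_intros w fc)
  have intw: "(\<lambda>t. norm (w t)) integrable_on {a..b}"
    by (intro integrable_continuous_real continuous_intros w)
  have "norm (\<Phi> b - \<Phi> a) \<le> integral {a..b} ?h"
  proof (rule increment_le_integral_if_locally[OF ab, where k = ?k])
    show "?h integrable_on {a..b}" "?k integrable_on {a..b}"
      using inth intw \<gamma>(1) by (auto intro!: integrable_on_mult_right integrable_add)
    fix e :: real assume e: "e > 0"
    have "continuous_on {a..b} (\<lambda>t. P (w t))" unfolding P_def by (intro continuous_intros w)
    from uniform_continuity_on_interval[OF this e]
    obtain d1 where d1: "d1 > 0" "\<And>s t. s \<in> {a..b} \<Longrightarrow> t \<in> {a..b} \<Longrightarrow> \<bar>t - s\<bar> < d1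
        \<Longrightarrow> norm (P (w t) - P (w s)) < e" by metis
    have "bounded (f ` {a..b})" using fc compact_continuous_image compact_imp_bounded by blast
    then obtain M where M: "M > 0" "\<And>t. t \<in> {a..b} \<Longrightarrow> norm (f t) \<le> M"
      by (force simp: bounded_pos)
    have "bounded (w ` {a..b})" using w compact_continuous_image compact_imp_bounded by blast
    then obtain m where m: "m > 0" "\<And>t. t \<in> {a..b} \<Longrightarrow> norm (w t) \<le> m"
      by (force simp: bounded_pos)
    \<comment> \<open>With these divisors, moving \<open>s\<close> and \<open>t\<close> to a common point \<open>r\<close> between them gives
      \<open>|f t| (|w t| + |w s|) \<le> 2 |f r| |w r| + e\<close>.\<close>
    have "e / (4 * M) > 0" using e M by simp
    from uniform_continuity_on_interval[OF w this]
    obtain d2 where d2: "d2 > 0" "\<And>s t. s \<in> {a..b} \<Longrightarrow> t \<in> {a..b} \<Longrightarrow> \<bar>t - s\<bar> < d2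
        \<Longrightarrow> norm (w t - w s) < e / (4 * M)" by metis
    have "e / (4 * m) > 0" using e m by simp
    from uniform_continuity_on_interval[OF fc this]
    obtain d3 where d3: "d3 > 0" "\<And>s t. s \<in> {a..b} \<Longrightarrow> t \<in> {a..b} \<Longrightarrow> \<bar>t - s\<bar> < d3
        \<Longrightarrow> norm (f t - f s) < e / (4 * m)" by metis
    show "\<exists>d>0. \<forall>s t. a \<le> s \<and> s \<le> t \<and> t \<le> b \<and> t - s < d \<longrightarrow>
       norm (\<Phi> t - \<Phi> s) \<le> integral {s..t} ?h + e * integral {s..t} ?k"
    proof (intro exI conjI allI impI)
      fix s t assume st: "a \<le> s \<and> s \<le> t \<and> t \<le> b \<and> t - s < min d1 (min d2 d3)"
      have sub: "u integrable_on {s..t}" if "u integrable_on {a..b}" for u :: "real \<Rightarrow> real"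
        using integrable_subinterval_real[OF that] st by auto
      have ws: "continuous_on {s..t} w" using w st continuous_on_subset by fastforce
      have Xst: "X t - X s = integral {s..t} (\<lambda>t. norm (w t) ^ 3)"
      proof -
        have "continuous_on {a..t} (\<lambda>t. norm (w t) ^ 3)"
          using st by (intro continuous_intros continuous_on_subset[OF w]) auto
        from Henstock_Kurzweil_Integration.integral_combine[OF _ _ integrable_continuous_real[OF this], of s] st
        show ?thesis unfolding X_def by auto
      qed
      \<comment> \<open>The main term is the increment of \<open>|w| w\<close>; the second one is of higher order, since \<open>|w| w\<close>
        varies little on \<open>[s,t]\<close>.\<close>
      have eq: "\<Phi> t - \<Phi> s = f t \<bullet> (P (w t) - P (w s)) + integral {s..t} (\<lambda>r. w r \<bullet> (P (w s) - P (w r)))"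
      proof -
        have wP: "w r \<bullet> P (w r) = norm (w r) ^ 3" for r
          by (simp add: P_def power3_eq_cube flip: power2_norm_eq_inner power2_eq_square)
        have "integral {s..t} (\<lambda>r. w r \<bullet> (P (w s) - P (w r)))
            = integral {s..t} (\<lambda>r. w r \<bullet> P (w s)) - integral {s..t} (\<lambda>r. norm (w r) ^ 3)"
          unfolding inner_diff_right wP
          by (intro Henstock_Kurzweil_Integration.integral_diff integrable_continuous_real continuous_intros ws)
        also have "integral {s..t} (\<lambda>r. w r \<bullet> P (w s)) = (f t - f s) \<bullet> P (w s)"
          using f[of s t] st integral_linear[OF integrable_continuous_real[OF ws] bounded_linear_inner_left[of "P (w s)"]]
          by (simp add: o_def)
        finally show ?thesis unfolding \<Phi>_def using Xst by (simp add: algebra_simps)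
      qed
      have I1: "norm (f t \<bullet> (P (w t) - P (w s))) \<le> integral {s..t} (\<lambda>r. ?h r + e * \<gamma> r)"
      proof -
        define n where "n = norm (f t) * (norm (w t) + norm (w s))"
        have "norm (f t \<bullet> (P (w t) - P (w s))) \<le> norm (f t) * norm (P (w t) - P (w s))"
          by (simp add: Cauchy_Schwarz_ineq2)
        also have "\<dots> \<le> norm (f t) * ((norm (w t) + norm (w s)) * norm (w t - w s))"
          unfolding P_def by (intro mult_left_mono norm_scaleR_norm_diff_le) auto
        also have "\<dots> \<le> n * integral {s..t} \<gamma>"
          unfolding n_def mult.assoc[symmetric] using inc[of s t] st by (intro mult_left_mono) auto
        also have "\<dots> = integral {s..t} (\<lambda>r. n * \<gamma> r)" by simp
        also have "\<dots> \<le> integral {s..t} (\<lambda>r. ?h r + e * \<gamma> r)"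
        proof (rule integral_le)
          show "(\<lambda>r. n * \<gamma> r) integrable_on {s..t}"
            by (intro integrable_on_mult_right sub \<gamma>)
          show "(\<lambda>r. ?h r + e * \<gamma> r) integrable_on {s..t}"
            by (intro integrable_add integrable_on_mult_right sub \<gamma> inth)
          fix r assume r: "r \<in> {s..t}"
          have fr: "norm (f t) \<le> norm (f r) + e / (4 * m)"
            using d3(2)[of r t] r st norm_triangle_ineq2[of "f t" "f r"] by auto
          have wr: "norm (w t) \<le> norm (w r) + e / (4 * M)" "norm (w s) \<le> norm (w r) + e / (4 * M)"
            using d2(2)[of r t] d2(2)[of r s] r st norm_triangle_ineq2[of "w t" "w r"]
               norm_triangle_ineq2[of "w s" "w r"] by auto
          have "n \<le> norm (f t) * (2 * norm (w r) + 2 * (e / (4 * M)))"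
            unfolding n_def using wr by (intro mult_left_mono) auto
          also have "\<dots> = 2 * (norm (f t) * norm (w r)) + norm (f t) * (2 * (e / (4 * M)))"
            by (simp add: algebra_simps)
          also have "\<dots> \<le> 2 * ((norm (f r) + e / (4 * m)) * norm (w r)) + M * (2 * (e / (4 * M)))"
            using fr M(2)[of t] st e M(1)
            by (intro add_mono mult_left_mono mult_right_mono) auto
          also have "\<dots> = 2 * (norm (f r) * norm (w r)) + 2 * (e / (4 * m) * norm (w r)) + e / 2"
            using M by (simp add: field_simps)
          also have "\<dots> \<le> 2 * (norm (f r) * norm (w r)) + 2 * (e / (4 * m) * m) + e / 2"
            using m(2)[of r] m(1) e r st by (intro add_mono mult_left_mono) auto
          also have "\<dots> = 2 * (norm (f r) * norm (w r)) + e"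
            using m by (simp add: field_simps)
          finally have "n * \<gamma> r \<le> (2 * (norm (f r) * norm (w r)) + e) * \<gamma> r"
            using \<gamma>(2)[of r] r st by (intro mult_right_mono) auto
          then show "n * \<gamma> r \<le> ?h r + e * \<gamma> r" by (simp add: algebra_simps)
        qed
        finally show ?thesis .
      qed
      have I2: "norm (integral {s..t} (\<lambda>r. w r \<bullet> (P (w s) - P (w r)))) \<le> integral {s..t} (\<lambda>r. e * norm (w r))"
      proof (rule Henstock_Kurzweil_Integration.integral_norm_bound_integral)
        show "(\<lambda>r. w r \<bullet> (P (w s) - P (w r))) integrable_on {s..t}"
          unfolding P_def by (intro integrable_continuous_real continuous_intros ws)
        show "(\<lambda>r. e * norm (w r)) integrable_on {s..t}"
          by (intro integrable_continuous_real continuous_intros ws)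
        fix r assume "r \<in> {s..t}"
        then have "norm (P (w s) - P (w r)) \<le> e" using d1(2)[of r s] st by auto
        then have "norm (w r) * norm (P (w s) - P (w r)) \<le> norm (w r) * e"
          by (intro mult_left_mono) auto
        then show "norm (w r \<bullet> (P (w s) - P (w r))) \<le> e * norm (w r)"
          using Cauchy_Schwarz_ineq2[of "w r" "P (w s) - P (w r)"] by (simp add: mult.commute)
      qed
      have "norm (\<Phi> t - \<Phi> s) \<le> integral {s..t} (\<lambda>r. ?h r + e * \<gamma> r) + integral {s..t} (\<lambda>r. e * norm (w r))"
        unfolding eq by (rule order_trans[OF norm_triangle_ineq add_mono[OF I1 I2]])
      also have "\<dots> = integral {s..t} ?h + e * integral {s..t} ?k"
        using sub[OF inth] sub[OF intw] sub[OF \<gamma>(1)]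
        by (simp add: Henstock_Kurzweil_Integration.integral_add integrable_on_mult_right distrib_left
            del: mult.assoc)
      finally show "norm (\<Phi> t - \<Phi> s) \<le> integral {s..t} ?h + e * integral {s..t} ?k" .
    qed (use d1 d2 d3 in auto)
  qed
  moreover have "\<bar>f t \<bullet> P (w t)\<bar> \<le> norm (f t) * norm (w t) ^ 2" for t
    using Cauchy_Schwarz_ineq2[of "f t" "P (w t)"] by (simp add: P_def power2_eq_square)
  from this[of a] this[of b] 
  have "\<bar>f b \<bullet> P (w b)\<bar> + \<bar>f a \<bullet> P (w a)\<bar> \<le> norm (f b) * norm (w b) ^ 2 + norm (f a) * norm (w a) ^ 2" by simp
  ultimately show ?thesis unfolding \<Phi>_def real_norm_def by (simp add: X_def)
qed

section \<open>Interpolation on an interval\<close>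

text \<open>
  The choice \<open>\<mu> = sqrt (Q / P)\<close> gives the claim. Replacing \<open>P\<close> and \<open>Q\<close> by \<open>P + e\<close> and \<open>Q + e\<close> keeps
  \<open>\<mu>\<close> meaningful when one of them vanishes. The next lemma is the same with exponents 3 and 3/2.
\<close>

lemma square_le_product_if_le_weighted:
  fixes S P Q :: real
  assumes "0 \<le> S" "0 \<le> P" "0 \<le> Q"
    and le: "\<And>\<mu>. \<mu> > 0 \<Longrightarrow> S \<le> (\<mu> * P + Q / \<mu>) / 2"
  shows "S ^ 2 \<le> P * Q"
proof -
  have "S ^ 2 \<le> (P + e) * (Q + e)" if e: "e > 0" for e
  proof -
    define p q where "p = sqrt (P + e)" and "q = sqrt (Q + e)"
    have pq: "p > 0" "q > 0" "p ^ 2 = P + e" "q ^ 2 = Q + e"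
      using e assms by (auto simp: p_def q_def)
    have "S \<le> (q / p * P + Q / (q / p)) / 2" using pq by (intro le) auto
    also have "\<dots> \<le> (q / p * p ^ 2 + q ^ 2 / (q / p)) / 2"
      using pq e by (intro divide_right_mono add_mono mult_left_mono) auto
    also have "\<dots> = p * q" using pq(1,2) by (simp add: field_simps power2_eq_square)
    finally have "S ^ 2 \<le> (p * q) ^ 2" using assms by (intro power_mono) auto
    then show ?thesis using pq by (simp add: power_mult_distrib)
  qed
  from le_at_0_if_le_right[of "\<lambda>e. (P + e) * (Q + e)" "S ^ 2", OF _ this] show ?thesis by simp
qed

lemma cube_le_product_if_le_weighted:
  fixes S P Q :: real
  assumes "0 \<le> S" "0 \<le> P" "0 \<le> Q"
    and le: "\<And>\<mu>. \<mu> > 0 \<Longrightarrow> S \<le> (2 * \<mu> * P + Q / \<mu> ^ 2) / 3"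
  shows "S ^ 3 \<le> P ^ 2 * Q"
proof -
  have "S ^ 3 \<le> (P + e) ^ 2 * (Q + e)" if e: "e > 0" for e
  proof -
    define p q where "p = root 3 (P + e)" and "q = root 3 (Q + e)"
    have pq: "p > 0" "q > 0" "p ^ 3 = P + e" "q ^ 3 = Q + e"
      using e assms by (auto simp: p_def q_def)
    have "S \<le> (2 * (q / p) * P + Q / (q / p) ^ 2) / 3" using pq by (intro le) auto
    also have "\<dots> \<le> (2 * (q / p) * p ^ 3 + q ^ 3 / (q / p) ^ 2) / 3"
      using pq e by (intro divide_right_mono add_mono mult_left_mono) auto
    also have "\<dots> = p ^ 2 * q" using pq(1,2) by (simp add: field_simps power2_eq_square power3_eq_cube)
    finally have "S ^ 3 \<le> (p ^ 2 * q) ^ 3" using assms by (intro power_mono) auto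
    also have "\<dots> = (p ^ 3) ^ 2 * q ^ 3" by (simp add: power_mult_distrib flip: power_mult)
    finally show ?thesis using pq by simp
  qed
  from le_at_0_if_le_right[of "\<lambda>e. (P + e) ^ 2 * (Q + e)" "S ^ 3", OF _ this] show ?thesis by simp
qed

lemma integral_mult_square_le:
  fixes k h :: "real \<Rightarrow> real"
  assumes k: "continuous_on {a..b} k" "\<And>t. t \<in> {a..b} \<Longrightarrow> 0 \<le> k t"
    and h: "h integrable_on {a..b}" "\<And>t. t \<in> {a..b} \<Longrightarrow> 0 \<le> h t" "(\<lambda>t. h t ^ 2) integrable_on {a..b}"
  shows "(integral {a..b} (\<lambda>t. k t * h t)) ^ 2 \<le> integral {a..b} (\<lambda>t. k t ^ 2) * integral {a..b} (\<lambda>t. h t ^ 2)"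
proof (rule square_le_product_if_le_weighted)
  have int: "(\<lambda>t. k t * h t) integrable_on {a..b}" by (intro integrable_continuous_mult k h)
  have ik: "(\<lambda>t. k t ^ 2) integrable_on {a..b}" by (intro integrable_continuous_real continuous_intros k)
  show "0 \<le> integral {a..b} (\<lambda>t. k t * h t)" using k h int
    by (intro Henstock_Kurzweil_Integration.integral_nonneg) auto
  show "0 \<le> integral {a..b} (\<lambda>t. k t ^ 2)" "0 \<le> integral {a..b} (\<lambda>t. h t ^ 2)"
    using ik h by (auto intro!: Henstock_Kurzweil_Integration.integral_nonneg)
  fix \<mu> :: real assume \<mu>: "\<mu> > 0"
  have "integral {a..b} (\<lambda>t. k t * h t) \<le> integral {a..b} (\<lambda>t. \<mu> / 2 * k t ^ 2 + 1 / (2 * \<mu>) * h t ^ 2)"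
  proof (rule integral_le[OF int])
    show "(\<lambda>t. \<mu> / 2 * k t ^ 2 + 1 / (2 * \<mu>) * h t ^ 2) integrable_on {a..b}"
      by (intro integrable_add integrable_on_mult_right ik h)
    fix t
    have "0 \<le> (\<mu> * k t - h t) ^ 2" by simp
    then have "2 * \<mu> * (k t * h t) \<le> \<mu> ^ 2 * k t ^ 2 + h t ^ 2" by (simp add: power2_diff power_mult_distrib algebra_simps)
    then show "k t * h t \<le> \<mu> / 2 * k t ^ 2 + 1 / (2 * \<mu>) * h t ^ 2"
      using \<mu> by (simp add: field_simps power2_eq_square)
  qed
  also have "\<dots> = \<mu> / 2 * integral {a..b} (\<lambda>t. k t ^ 2) + 1 / (2 * \<mu>) * integral {a..b} (\<lambda>t. h t ^ 2)"
    by (subst Henstock_Kurzweil_Integration.integral_add) ((intro integrable_on_mult_right ik h)+, simp)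
  finally show "integral {a..b} (\<lambda>t. k t * h t)
     \<le> (\<mu> * integral {a..b} (\<lambda>t. k t ^ 2) + integral {a..b} (\<lambda>t. h t ^ 2) / \<mu>) / 2"
    using \<mu> by (simp add: field_simps)
qed

text \<open>
  Hoelder's inequality with exponents 3/2 and 3, in the only two combinations that are needed: with
  \<open>x = |f|^2\<close> and \<open>y = |w|\<close>, and with \<open>x = |w|\<close> and \<open>y = |f|^2\<close>.
\<close>

lemma integral_square_mult_cube_le:
  fixes x y :: "real \<Rightarrow> real"
  assumes x: "continuous_on {a..b} x" "\<And>t. 0 \<le> x t" and y: "continuous_on {a..b} y" "\<And>t. 0 \<le> y t"
  shows "(integral {a..b} (\<lambda>t. x t ^ 2 * y t)) ^ 3
           \<le> (integral {a..b} (\<lambda>t. x t ^ 3)) ^ 2 * integral {a..b} (\<lambda>t. y t ^ 3)"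
proof (rule cube_le_product_if_le_weighted)
  have int: "(\<lambda>t. x t ^ 2 * y t) integrable_on {a..b}"
    by (intro integrable_continuous_real continuous_intros x y)
  have ix: "(\<lambda>t. x t ^ 3) integrable_on {a..b}" and iy: "(\<lambda>t. y t ^ 3) integrable_on {a..b}"
    by (intro integrable_continuous_real continuous_intros x y)+
  show "0 \<le> integral {a..b} (\<lambda>t. x t ^ 2 * y t)" using x y int
    by (intro Henstock_Kurzweil_Integration.integral_nonneg) auto
  show "0 \<le> integral {a..b} (\<lambda>t. x t ^ 3)" "0 \<le> integral {a..b} (\<lambda>t. y t ^ 3)"
    using ix iy x y by (auto intro!: Henstock_Kurzweil_Integration.integral_nonneg)
  fix \<mu> :: real assume \<mu>: "\<mu> > 0"
  have "integral {a..b} (\<lambda>t. x t ^ 2 * y t) \<le> integral {a..b} (\<lambda>t. 2 * \<mu> / 3 * x t ^ 3 + 1 / (3 * \<mu> ^ 2) * y t ^ 3)"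
  proof (rule integral_le[OF int])
    show "(\<lambda>t. 2 * \<mu> / 3 * x t ^ 3 + 1 / (3 * \<mu> ^ 2) * y t ^ 3) integrable_on {a..b}"
      by (intro integrable_add integrable_on_mult_right ix iy)
    fix t
    have "0 \<le> (\<mu> * x t - y t) ^ 2 * (2 * (\<mu> * x t) + y t)" using x y \<mu> by simp
    also have "\<dots> = 2 * \<mu> ^ 3 * x t ^ 3 + y t ^ 3 - 3 * \<mu> ^ 2 * (x t ^ 2 * y t)"
      by (simp add: power2_eq_square power3_eq_cube algebra_simps)
    finally have "3 * \<mu> ^ 2 * (x t ^ 2 * y t) \<le> 2 * \<mu> ^ 3 * x t ^ 3 + y t ^ 3" by simp
    then have "(3 * \<mu> ^ 2 * (x t ^ 2 * y t)) / (3 * \<mu> ^ 2) \<le> (2 * \<mu> ^ 3 * x t ^ 3 + y t ^ 3) / (3 * \<mu> ^ 2)"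
      by (rule divide_right_mono) simp
    then show "x t ^ 2 * y t \<le> 2 * \<mu> / 3 * x t ^ 3 + 1 / (3 * \<mu> ^ 2) * y t ^ 3"
      using \<mu> by (simp add: add_divide_distrib power2_eq_square power3_eq_cube)
  qed
  also have "\<dots> = 2 * \<mu> / 3 * integral {a..b} (\<lambda>t. x t ^ 3) + 1 / (3 * \<mu> ^ 2) * integral {a..b} (\<lambda>t. y t ^ 3)"
    by (subst Henstock_Kurzweil_Integration.integral_add) ((intro integrable_on_mult_right ix iy)+, simp)
  finally show "integral {a..b} (\<lambda>t. x t ^ 2 * y t)
     \<le> (2 * \<mu> * integral {a..b} (\<lambda>t. x t ^ 3) + integral {a..b} (\<lambda>t. y t ^ 3) / \<mu> ^ 2) / 3"
    using \<mu> by (simp add: field_simps)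
qed

text \<open>
  Either the interior term \<open>2 Q\<close> or the boundary term \<open>2 M m^2\<close> is at least half of \<open>X\<close>. Raising this
  to the power 6 or 15 makes all exponents integral, after which a positive power of \<open>X\<close> cancels.
\<close>

lemma fourth_power_le_from_bounds:
  fixes X \<alpha> B M m Q :: real
  assumes nn: "0 \<le> X" "0 \<le> \<alpha>" "0 \<le> B" "0 \<le> M" "0 \<le> m" "0 \<le> Q"
    and X: "X \<le> 2 * M * m ^ 2 + 2 * Q"
    and Q: "Q ^ 6 \<le> X ^ 2 * \<alpha> * B ^ 3"
    and m: "m ^ 5 \<le> 16 * X * B"
    and M: "M ^ 15 \<le> 2 ^ 15 * \<alpha> ^ 2 * X"
  shows "X ^ 4 \<le> 2 ^ 36 * (\<alpha> * B ^ 3)"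
proof (cases "X = 0")
  case True
  then show ?thesis using nn by simp
next
  case False
  then have Xp: "X > 0" using nn by simp
  show ?thesis
  proof (cases "X \<le> 4 * Q")
    case True
    then have "X ^ 6 \<le> (4 * Q) ^ 6" using nn by (intro power_mono)
    also have "\<dots> \<le> 4 ^ 6 * (X ^ 2 * \<alpha> * B ^ 3)" using Q by (simp add: power_mult_distrib)
    finally have "X ^ 2 * X ^ 4 \<le> X ^ 2 * (4 ^ 6 * (\<alpha> * B ^ 3))" by (simp add: mult_ac flip: power_add)
    then have "X ^ 4 \<le> 4 ^ 6 * (\<alpha> * B ^ 3)" using Xp by (simp only: mult_le_cancel_left_pos zero_less_power)
    also have "\<dots> \<le> 2 ^ 36 * (\<alpha> * B ^ 3)" using nn by (intro mult_right_mono) auto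
    finally show ?thesis .
  next
    case False
    then have "X \<le> 4 * M * m ^ 2" using X by simp
    then have "X ^ 15 \<le> (4 * M * m ^ 2) ^ 15" using nn by (intro power_mono)
    also have "\<dots> = 4 ^ 15 * (M ^ 15 * (m ^ 5) ^ 6)" by (simp add: power_mult_distrib flip: power_mult)
    also have "\<dots> \<le> 4 ^ 15 * ((2 ^ 15 * \<alpha> ^ 2 * X) * (16 * X * B) ^ 6)"
      using nn M m by (intro mult_left_mono mult_mono power_mono) auto
    also have "\<dots> = X ^ 7 * (2 ^ 69 * \<alpha> ^ 2 * B ^ 6)" by (simp add: power_mult_distrib eval_nat_numeral)
    finally have "X ^ 7 * X ^ 8 \<le> X ^ 7 * (2 ^ 69 * \<alpha> ^ 2 * B ^ 6)" by (simp flip: power_add)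
    then have "X ^ 8 \<le> 2 ^ 69 * \<alpha> ^ 2 * B ^ 6" using Xp by (simp only: mult_le_cancel_left_pos zero_less_power)
    also have "\<dots> \<le> 2 ^ 72 * \<alpha> ^ 2 * B ^ 6" using nn by (intro mult_right_mono) auto
    also have "\<dots> = (2 ^ 36 * (\<alpha> * B ^ 3)) ^ 2" by (simp add: power_mult_distrib flip: power_mult)
    finally have "(X ^ 4) ^ 2 \<le> (2 ^ 36 * (\<alpha> * B ^ 3)) ^ 2" by (simp flip: power_mult)
    then show ?thesis by (rule power2_le_imp_le) (use nn in auto)
  qed
qed

text \<open>
  The second alternative is invariant under scaling of time and of the values of \<open>f\<close>. It fails for
  non-constant affine functions, for which \<open>B = 0\<close>; the first alternative covers them and all functions whose
  derivative never becomes much larger than it is at time 0.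
\<close>

lemma interpolation_on_interval:
  fixes f w :: "real \<Rightarrow> 'a::euclidean_space"
  assumes T: "T > 0" and w: "continuous_on {0..T} w"
    and f: "\<And>s t. 0 \<le> s \<Longrightarrow> s \<le> t \<Longrightarrow> t \<le> T \<Longrightarrow> f t - f s = integral {s..t} w"
    and \<gamma>: "\<gamma> integrable_on {0..T}" "\<And>t. t \<in> {0..T} \<Longrightarrow> 0 \<le> \<gamma> t" "(\<lambda>t. \<gamma> t ^ 2) integrable_on {0..T}"
    and inc: "\<And>s t. 0 \<le> s \<Longrightarrow> s \<le> t \<Longrightarrow> t \<le> T \<Longrightarrow> norm (w t - w s) \<le> integral {s..t} \<gamma>"
  defines "X \<equiv> integral {0..T} (\<lambda>t. norm (w t) ^ 3)"
    and "\<alpha> \<equiv> integral {0..T} (\<lambda>t. norm (f t) ^ 6)"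
    and "B \<equiv> integral {0..T} (\<lambda>t. \<gamma> t ^ 2)"
  shows "X \<le> 8 * T * norm (w 0) ^ 3 \<or> X ^ 4 \<le> 2 ^ 36 * (\<alpha> * B ^ 3)"
proof -
  have "continuous_on {0..T} (\<lambda>t. f 0 + integral {0..t} w)"
    by (intro continuous_intros indefinite_integral_continuous_1 integrable_continuous_real w)
  then have fc: "continuous_on {0..T} f"
    by (rule continuous_on_eq) (use f in \<open>force simp flip: f\<close>)
  have nw: "continuous_on {0..T} (\<lambda>t. norm (w t))" and nf: "continuous_on {0..T} (\<lambda>t. norm (f t))"
    by (intro continuous_intros w fc)+
  have ne: "{0..T} \<noteq> {}" using T by simp
  note intC = integrable_continuous_real
  note nonneg = Henstock_Kurzweil_Integration.integral_nonneg
  obtain t1 where t1: "t1 \<in> {0..T}" "\<And>t. t \<in> {0..T} \<Longrightarrow> norm (w t) \<le> norm (w t1)"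
    using continuous_attains_sup[OF compact_Icc ne nw] by auto
  obtain t2 where t2: "t2 \<in> {0..T}" "\<And>t. t \<in> {0..T} \<Longrightarrow> norm (f t) \<le> norm (f t2)"
    using continuous_attains_sup[OF compact_Icc ne nf] by auto
  obtain t0 where t0: "t0 \<in> {0..T}" "\<And>t. t \<in> {0..T} \<Longrightarrow> norm (f t0) \<le> norm (f t)"
    using continuous_attains_inf[OF compact_Icc ne nf] by auto
  define m M \<mu> c where "m = norm (w t1)" and "M = norm (f t2)" and "\<mu> = norm (f t0)" and "c = norm (w 0)"
  have nn: "0 \<le> m" "0 \<le> M" "0 \<le> \<mu>" "0 \<le> c" by (auto simp: m_def M_def \<mu>_def c_def)
  have const: "integral {0..T} (\<lambda>t. r) = r * T" for r :: real using T by simp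
  have X0: "0 \<le> X" unfolding X_def by (intro nonneg intC continuous_intros nw) auto
  have a0: "0 \<le> \<alpha>" unfolding \<alpha>_def by (intro nonneg intC continuous_intros nf) auto
  have B0: "0 \<le> B" unfolding B_def by (intro nonneg \<gamma>) auto
  have XT: "X \<le> m ^ 3 * T"
    unfolding X_def const[symmetric] by (intro integral_le intC continuous_intros nw)
      (auto simp: m_def intro!: power_mono t1)
  show ?thesis
  proof (cases "m \<le> 2 * c")
    case True
    have "X \<le> (2 * c) ^ 3 * T"
      using XT True nn T by (intro order_trans[OF XT] mult_right_mono power_mono) auto
    then show ?thesis by (simp add: c_def power_mult_distrib mult_ac)
  next
    case cm: False
    define S where "S = integral {0..T} (\<lambda>t. norm (w t) ^ 2 * \<gamma> t)"
    define Q where "Q = integral {0..T} (\<lambda>t. norm (f t) * norm (w t) * \<gamma> t)"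
    define R where "R = integral {0..T} (\<lambda>t. norm (f t) ^ 4 * norm (w t))"
    define G where "G = integral {0..T} \<gamma>"
    have sub1: "integral {0..t1} u \<le> integral {0..T} u"
      if "u integrable_on {0..T}" "\<And>t. t \<in> {0..T} \<Longrightarrow> 0 \<le> u t" for u :: "real \<Rightarrow> real"
      using that t1 by (intro integral_subset_le integrable_subinterval_real[OF that(1)]) auto
    have G2: "G ^ 2 \<le> T * B"
      using integral_mult_square_le[of 0 T "\<lambda>_. 1" \<gamma>] \<gamma> T by (simp add: G_def B_def)
    \<comment> \<open>In the present case \<open>m - c \<ge> m / 2\<close>, so the growth of \<open>w\<close> after time 0 controls \<open>m\<close> itself.\<close>
    have "m - c \<le> norm (w t1 - w 0)" unfolding m_def c_def by (rule norm_triangle_ineq2)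
    also have "\<dots> \<le> G" using inc[of 0 t1] sub1[OF \<gamma>(1,2)] t1 by (auto simp: G_def)
    finally have "m \<le> 2 * G" using cm by simp
    then have m2: "m ^ 2 \<le> 4 * (T * B)" using G2 nn power_mono[of m "2 * G" 2] by (simp add: power_mult_distrib)
    have iS: "(\<lambda>t. norm (w t) ^ 2 * \<gamma> t) integrable_on {0..T}"
      by (intro integrable_continuous_mult \<gamma> continuous_intros nw)
    have "m ^ 3 - c ^ 3 \<le> 3 * integral {0..t1} (\<lambda>t. norm (w t) ^ 2 * \<gamma> t)"
    proof -
      have "\<bar>norm (w t1) ^ Suc 2 - norm (w 0) ^ Suc 2\<bar>
         \<le> real (Suc 2) * integral {0..t1} (\<lambda>t. norm (w t) ^ 2 * \<gamma> t)"
        using t1 \<gamma> inc by (intro norm_power_increment_le continuous_on_subset[OF w]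
              integrable_subinterval_real[OF \<gamma>(1)]) auto
      then show ?thesis by (simp add: m_def c_def eval_nat_numeral)
    qed
    also have "\<dots> \<le> 3 * S" unfolding S_def
      by (intro mult_left_mono sub1 iS) (use \<gamma> in auto)
    finally have "m ^ 3 - c ^ 3 \<le> 3 * S" .
    moreover have "c ^ 3 \<le> (m / 2) ^ 3" using nn cm by (intro power_mono) auto
    then have "c ^ 3 \<le> m ^ 3 / 8" by (simp add: power_divide)
    ultimately have "m ^ 3 \<le> 4 * S" using zero_le_power[OF nn(1), of 3] by linarith
    \<comment> \<open>By the Cauchy--Schwarz inequality, \<open>S\<^sup>2\<close> is at most the integral of \<open>|w|^4\<close> times \<open>B\<close>, and one
      factor \<open>|w| \<le> m\<close> can be taken out of that integral.\<close>
    then have "(m ^ 3) ^ 2 \<le> (4 * S) ^ 2" using nn by (intro power_mono) auto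
    also have "\<dots> = 16 * S ^ 2" by (simp add: power_mult_distrib)
    also have "S ^ 2 \<le> integral {0..T} (\<lambda>t. (norm (w t) ^ 2) ^ 2) * B"
      unfolding S_def B_def by (intro integral_mult_square_le continuous_intros nw \<gamma>) auto
    also have "\<dots> \<le> (m * X) * B"
    proof (intro mult_right_mono B0)
      have "integral {0..T} (\<lambda>t. (norm (w t) ^ 2) ^ 2) \<le> integral {0..T} (\<lambda>t. m * norm (w t) ^ 3)"
      proof (intro integral_le intC continuous_intros w)
        fix t assume "t \<in> {0..T}"
        then have "norm (w t) * norm (w t) ^ 3 \<le> m * norm (w t) ^ 3"
          unfolding m_def by (intro mult_right_mono t1) auto
        then show "((norm (w t))\<^sup>2)\<^sup>2 \<le> m * norm (w t) ^ 3" by (simp add: eval_nat_numeral mult_ac)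
      qed
      then show "integral {0..T} (\<lambda>t. (norm (w t) ^ 2) ^ 2) \<le> m * X" by (simp add: X_def)
    qed
    finally have "m * m ^ 5 \<le> m * (16 * X * B)" by (simp add: eval_nat_numeral mult_ac)
    moreover have "m > 0" using cm nn by simp
    ultimately have m5: "m ^ 5 \<le> 16 * X * B" by (simp only: mult_le_cancel_left_pos)
    show ?thesis
    proof (cases "X ^ 2 * T ^ 5 \<le> \<alpha>")
      case True
      have "X ^ 2 \<le> (m ^ 3 * T) ^ 2" using XT X0 by (intro power_mono)
      also have "\<dots> = (m ^ 2) ^ 3 * T ^ 2" by (simp add: power_mult_distrib flip: power_mult)
      also have "\<dots> \<le> (4 * (T * B)) ^ 3 * T ^ 2" using m2 by (intro mult_right_mono power_mono) auto
      also have "\<dots> = 64 * T ^ 5 * B ^ 3" by (simp add: power_mult_distrib eval_nat_numeral)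
      finally have "X ^ 2 * X ^ 2 \<le> X ^ 2 * (64 * T ^ 5 * B ^ 3)" by (intro mult_left_mono) auto
      also have "\<dots> = (X ^ 2 * T ^ 5) * (64 * B ^ 3)" by simp
      also have "\<dots> \<le> \<alpha> * (64 * B ^ 3)" using True B0 by (intro mult_right_mono) auto
      also have "\<dots> \<le> 2 ^ 36 * (\<alpha> * B ^ 3)" using a0 B0 by simp
      finally show ?thesis by (simp flip: power_add)
    next
      case aX: False
      \<comment> \<open>The minimum \<open>\<mu>\<close> of \<open>|f|\<close> is controlled by \<open>\<alpha>\<close>, and the growth from the minimum to the maximum
        \<open>M\<close> by the chain rule for \<open>|f|^6\<close>.\<close>
      have "\<mu> ^ 6 * T \<le> \<alpha>"
        unfolding \<alpha>_def const[symmetric] by (intro integral_le intC continuous_intros nf)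
          (auto simp: \<mu>_def intro!: power_mono t0)
      have R3: "R ^ 3 \<le> \<alpha> ^ 2 * X"
        using integral_square_mult_cube_le[of 0 T "\<lambda>t. norm (f t) ^ 2" "\<lambda>t. norm (w t)"] nf nw
        by (simp add: R_def \<alpha>_def X_def continuous_intros flip: power_mult)
      have "M ^ 6 - \<mu> ^ 6 \<le> 6 * (M * R)"
      proof -
        have incf: "norm (f t - f s) \<le> integral {s..t} (\<lambda>t. norm (w t))" if "0 \<le> s" "s \<le> t" "t \<le> T" for s t
        proof -
          have "continuous_on {s..t} w" using that by (intro continuous_on_subset[OF w]) auto
          then show ?thesis unfolding f[OF that]
            by (intro Henstock_Kurzweil_Integration.integral_norm_bound_integral intC continuous_intros) auto
        qed
        have i5: "(\<lambda>t. norm (f t) ^ 5 * norm (w t)) integrable_on {0..T}"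
          by (intro intC continuous_intros nf nw)
        have *: "\<bar>norm (f t) ^ 6 - norm (f s) ^ 6\<bar> \<le> 6 * (M * R)" if "0 \<le> s" "s \<le> t" "t \<le> T" for s t
        proof -
          have "\<bar>norm (f t) ^ Suc 5 - norm (f s) ^ Suc 5\<bar>
            \<le> real (Suc 5) * integral {s..t} (\<lambda>t. norm (f t) ^ 5 * norm (w t))"
            using that incf by (intro norm_power_increment_le continuous_on_subset[OF fc] intC
              continuous_on_subset[OF nw]) auto
          also have "\<dots> \<le> real (Suc 5) * integral {0..T} (\<lambda>t. norm (f t) ^ 5 * norm (w t))"
            using that by (intro mult_left_mono integral_subset_le i5 integrable_subinterval_real[OF i5]) auto
          also have "integral {0..T} (\<lambda>t. norm (f t) ^ 5 * norm (w t))
              \<le> integral {0..T} (\<lambda>t. M * (norm (f t) ^ 4 * norm (w t)))"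
          proof (intro integral_le i5 intC continuous_intros fc w)
            fix t assume "t \<in> {0..T}"
            then have "norm (f t) * (norm (f t) ^ 4 * norm (w t)) \<le> M * (norm (f t) ^ 4 * norm (w t))"
              unfolding M_def by (intro mult_right_mono t2) auto
            then show "norm (f t) ^ 5 * norm (w t) \<le> M * (norm (f t) ^ 4 * norm (w t))"
              by (simp add: eval_nat_numeral mult_ac)
          qed
          finally show ?thesis by (simp add: R_def eval_nat_numeral)
        qed
        show ?thesis
          using *[of t0 t2] *[of t2 t0] t0(1) t2(1) unfolding M_def \<mu>_def by (cases "t0 \<le> t2") auto
      qed
      have M15: "M ^ 15 \<le> 2 ^ 15 * \<alpha> ^ 2 * X"
      proof (cases "M \<le> 2 * \<mu>")
        case True
        then have "M ^ 6 * T \<le> (2 * \<mu>) ^ 6 * T" using nn T by (intro mult_right_mono power_mono) auto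
        also have "\<dots> \<le> 64 * \<alpha>" using \<open>\<mu> ^ 6 * T \<le> \<alpha>\<close> by (simp add: power_mult_distrib)
        finally have "(M ^ 6 * T) ^ 5 \<le> (64 * \<alpha>) ^ 5" using nn T by (intro power_mono) auto
        also have "\<dots> = 2 ^ 30 * \<alpha> ^ 4 * \<alpha>" by (simp add: power_mult_distrib eval_nat_numeral)
        also have "\<dots> \<le> 2 ^ 30 * \<alpha> ^ 4 * (X ^ 2 * T ^ 5)" using aX a0 by (intro mult_left_mono) auto
        finally have "T ^ 5 * M ^ 30 \<le> T ^ 5 * (2 ^ 30 * \<alpha> ^ 4 * X ^ 2)"
          by (simp add: power_mult_distrib mult_ac flip: power_mult)
        then have "M ^ 30 \<le> 2 ^ 30 * \<alpha> ^ 4 * X ^ 2" using T by (simp only: mult_le_cancel_left_pos zero_less_power)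
        then have "(M ^ 15) ^ 2 \<le> (2 ^ 15 * \<alpha> ^ 2 * X) ^ 2" by (simp add: power_mult_distrib flip: power_mult)
        then show ?thesis by (rule power2_le_imp_le) (use a0 X0 in auto)
      next
        case False
        then have "\<mu> ^ 6 \<le> (M / 2) ^ 6" using nn by (intro power_mono) auto
        then have "\<mu> ^ 6 \<le> M ^ 6 / 64" by (simp add: power_divide)
        then have "M ^ 6 \<le> 8 * (M * R)"
          using \<open>M ^ 6 - \<mu> ^ 6 \<le> 6 * (M * R)\<close> zero_le_power[OF nn(2), of 6] by linarith
        then have "M * M ^ 5 \<le> M * (8 * R)" by (simp add: eval_nat_numeral)
        moreover have "M > 0" using False nn by simp
        ultimately have "M ^ 5 \<le> 8 * R" by (simp only: mult_le_cancel_left_pos)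
        then have "(M ^ 5) ^ 3 \<le> (8 * R) ^ 3" using nn by (intro power_mono) auto
        also have "\<dots> \<le> 2 ^ 9 * (\<alpha> ^ 2 * X)" using R3 by (simp add: power_mult_distrib)
        also have "\<dots> \<le> 2 ^ 15 * (\<alpha> ^ 2 * X)" using a0 X0 by (intro mult_right_mono) auto
        finally show ?thesis by (simp add: mult_ac flip: power_mult)
      qed
      have Q0: "0 \<le> Q" unfolding Q_def
        by (intro nonneg integrable_continuous_mult \<gamma> continuous_intros nf nw) (use \<gamma> in auto)
      have "X \<le> norm (f T) * norm (w T) ^ 2 + norm (f 0) * norm (w 0) ^ 2 + 2 * Q"
        unfolding X_def Q_def using T w f \<gamma> inc by (intro integral_norm_cube_le_by_parts) auto
      also have "\<dots> \<le> M * m ^ 2 + M * m ^ 2 + 2 * Q"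
        unfolding M_def m_def using T Q0 by (intro add_mono mult_mono power_mono t1 t2) auto
      finally have XQ: "X \<le> 2 * M * m ^ 2 + 2 * Q" by simp
      define P where "P = integral {0..T} (\<lambda>t. (norm (f t) * norm (w t)) ^ 2)"
      have P0: "0 \<le> P" unfolding P_def by (intro nonneg intC continuous_intros nf nw) auto
      have "Q ^ 2 \<le> P * B"
        unfolding Q_def B_def P_def by (intro integral_mult_square_le continuous_intros nf nw \<gamma>) auto
      then have "(Q ^ 2) ^ 3 \<le> (P * B) ^ 3" by (intro power_mono) auto
      also have "\<dots> = P ^ 3 * B ^ 3" by (simp add: power_mult_distrib)
      also have "P ^ 3 * B ^ 3 \<le> X ^ 2 * \<alpha> * B ^ 3"
      proof (rule mult_right_mono)
        show "P ^ 3 \<le> X ^ 2 * \<alpha>"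
          using integral_square_mult_cube_le[of 0 T "\<lambda>t. norm (w t)" "\<lambda>t. norm (f t) ^ 2"] nf nw
          by (simp add: P_def \<alpha>_def X_def continuous_intros power_mult_distrib mult.commute flip: power_mult)
      qed (use B0 in auto)
      finally have Q6: "Q ^ 6 \<le> X ^ 2 * \<alpha> * B ^ 3" by (simp flip: power_mult)
      show ?thesis
        using fourth_power_le_from_bounds[OF X0 a0 B0 nn(2) nn(1) Q0 XQ Q6 m5 M15] by blast
    qed
  qed
qed

text \<open>
  The product \<open>\<alpha> B^3\<close> is \<open>u v^3\<close> with \<open>u = \<alpha> / l^3\<close> and \<open>v = l B\<close>, and each factor is at most
  \<open>u + v\<close>. In contrast to \<open>\<alpha>^(1/4) B^(3/4)\<close>, the resulting bound is linear in \<open>\<alpha>\<close> and \<open>B\<close>.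
\<close>

lemma le_weighted_sum_if_fourth_power_le:
  fixes X \<alpha> B l :: real
  assumes "X ^ 4 \<le> 2 ^ 36 * (\<alpha> * B ^ 3)" "0 \<le> \<alpha>" "0 \<le> B" "l > 0"
  shows "X \<le> 2 ^ 9 * (\<alpha> / l ^ 3 + l * B)"
proof (rule power_le_imp_le_base[of _ 3])
  define u v where "u = \<alpha> / l ^ 3" and "v = l * B"
  have nn: "0 \<le> u" "0 \<le> v" using assms by (auto simp: u_def v_def)
  have "X ^ Suc 3 \<le> 2 ^ 36 * (u * v ^ 3)" using assms by (simp add: u_def v_def power_mult_distrib eval_nat_numeral)
  also have "\<dots> \<le> 2 ^ 36 * ((u + v) * (u + v) ^ 3)"
    using nn by (intro mult_left_mono mult_mono power_mono) auto
  also have "\<dots> = (2 ^ 9 * (u + v)) ^ Suc 3"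
    unfolding power_mult_distrib power_Suc[symmetric] by simp
  finally show "X ^ Suc 3 \<le> (2 ^ 9 * (\<alpha> / l ^ 3 + l * B)) ^ Suc 3" unfolding u_def v_def .
  show "0 \<le> 2 ^ 9 * (\<alpha> / l ^ 3 + l * B)" using nn by (simp add: u_def v_def)
qed

section \<open>Smooth test functions\<close>

text \<open>
  The usual smooth function that vanishes to infinite order at 0, divided by powers of \<open>y\<close> so that
  the family is closed under differentiation.
\<close>

definition flat :: "real \<Rightarrow> nat \<Rightarrow> real \<Rightarrow> real" where
  "flat s k y = (if y > 0 then exp (- s / y) / y ^ k else 0)"

lemma tendsto_flat_0:
  assumes "s > 0"
  shows "(flat s k \<longlongrightarrow> 0) (at 0)"
proof (rule filterlim_split_at_real)
  have "((\<lambda>y. (s / y) ^ k / exp (s / y) / s ^ k) \<longlongrightarrow> 0 / s ^ k) (at_right 0)"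
  proof (intro tendsto_divide tendsto_const filterlim_compose[OF tendsto_power_div_exp_0])
    show "filterlim ((/) s) at_top (at_right 0)"
      unfolding divide_inverse
      by (intro filterlim_tendsto_pos_mult_at_top[OF tendsto_const assms] filterlim_inverse_at_top_right)
  qed (use assms in auto)
  then have "((\<lambda>y. (s / y) ^ k / exp (s / y) / s ^ k) \<longlongrightarrow> 0) (at_right 0)" by simp
  then show "(flat s k \<longlongrightarrow> 0) (at_right 0)"
  proof (rule Lim_transform_eventually)
    show "\<forall>\<^sub>F y in at_right 0. (s / y) ^ k / exp (s / y) / s ^ k = flat s k y"
      using eventually_at_right_less[of "0::real"]
      by eventually_elim (use assms in \<open>simp add: flat_def exp_minus power_divide field_simps\<close>)
  qed
  show "(flat s k \<longlongrightarrow> 0) (at_left 0)"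
  proof (rule Lim_transform_eventually[OF tendsto_const])
    show "\<forall>\<^sub>F y in at_left 0. 0 = flat s k y"
      using eventually_at_left_field[of "\<lambda>y. 0 = flat s k y" "0::real"] by (auto simp: flat_def intro: lt_ex)
  qed
qed

lemma has_derivative_flat:
  assumes s: "s > 0"
  shows "(flat s k has_real_derivative s * flat s (k + 2) y - real k * flat s (k + 1) y) (at y)"
proof (cases y "0::real" rule: linorder_cases)
  case greater
  have "((\<lambda>y. exp (- s / y) / y ^ k) has_real_derivative s * flat s (k + 2) y - real k * flat s (k + 1) y) (at y)"
    using greater
    apply (auto intro!: derivative_eq_intros simp: flat_def)
    apply (cases k)
     apply (auto simp: field_simps power2_eq_square)
    done
  then show ?thesis
    by (rule DERIV_cong_ev[OF refl _ refl, THEN iffD1, rotated])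
       (use greater eventually_gt_at_top in \<open>auto simp: flat_def eventually_nhds intro!: exI[of _ "{0<..}"]\<close>)
next
  case less
  have "((\<lambda>y. 0) has_real_derivative 0) (at y)" by simp
  then have "(flat s k has_real_derivative 0) (at y)"
    by (rule DERIV_cong_ev[OF refl _ refl, THEN iffD1, rotated])
       (use less in \<open>auto simp: flat_def eventually_nhds intro!: exI[of _ "{..<0}"]\<close>)
  then show ?thesis using less by (simp add: flat_def)
next
  case equal
  have "(flat s (Suc k) \<longlongrightarrow> 0) (at 0)" by (rule tendsto_flat_0[OF s])
  then have "((\<lambda>h. (flat s k (0 + h) - flat s k 0) / h) \<longlongrightarrow> 0) (at 0)"
    by (rule filterlim_cong[THEN iffD1, OF refl refl, rotated])
      (auto simp: flat_def eventually_at_filter)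
  then show ?thesis using equal by (simp add: DERIV_def flat_def)
qed

definition smooth :: "(real \<Rightarrow> real) \<Rightarrow> bool" where
  "smooth \<phi> \<longleftrightarrow> (\<forall>n t. (deriv ^^ n) \<phi> differentiable (at t))"

text \<open>
  Functions of this form are closed under differentiation. Because \<open>flat s k y = y * flat s (k + 1) y\<close>,
  the derivative can again be written with a single term instead of a sum.
\<close>

lemma smooth_poly_flat:
  assumes s: "s > 0"
  shows "smooth (\<lambda>t. poly p t * flat s k (poly q t))"
proof -
  have d: "((\<lambda>t. poly p t * flat s k (poly q t)) has_real_derivative
      poly (pderiv p * q ^ 2 + p * pderiv q * ([:s:] - of_nat k * q)) t * flat s (k + 2) (poly q t)) (at t)" for p k t
  proof -
    have up: "flat s j y = y * flat s (j + 1) y" for j y by (simp add: flat_def)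
    have up2: "flat s k y = y ^ 2 * flat s (k + 2) y" for y
      by (subst up, subst up) (simp add: power2_eq_square)
    have "((\<lambda>t. poly p t * flat s k (poly q t)) has_real_derivative
      poly (pderiv p) t * flat s k (poly q t)
      + poly p t * ((s * flat s (k + 2) (poly q t) - real k * flat s (k + 1) (poly q t)) * poly (pderiv q) t)) (at t)"
      by (auto intro!: derivative_eq_intros DERIV_chain2[OF has_derivative_flat[OF s]] simp: mult.commute)
    moreover have up1: "flat s (k + 1) y = y * flat s (k + 2) y" for y using up[of "k + 1"] by simp
    ultimately show ?thesis unfolding up2 up1 by (simp add: algebra_simps)
  qed
  have "\<exists>p' k'. (deriv ^^ n) (\<lambda>t. poly p t * flat s k (poly q t)) = (\<lambda>t. poly p' t * flat s k' (poly q t))" for n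
  proof (induction n)
    case (Suc n)
    then obtain p' k' where "(deriv ^^ n) (\<lambda>t. poly p t * flat s k (poly q t)) = (\<lambda>t. poly p' t * flat s k' (poly q t))"
      by blast
    then have "(deriv ^^ Suc n) (\<lambda>t. poly p t * flat s k (poly q t)) = deriv (\<lambda>t. poly p' t * flat s k' (poly q t))"
      by simp
    also have "\<dots> = (\<lambda>t. poly (pderiv p' * q ^ 2 + p' * pderiv q * ([:s:] - of_nat k' * q)) t * flat s (k' + 2) (poly q t))"
      by (rule ext) (rule DERIV_imp_deriv[OF d])
    finally show ?case by blast
  qed (simp, blast)
  moreover have "(\<lambda>t. poly p t * flat s k (poly q t)) differentiable at t" for p k t
    using d unfolding real_differentiable_def by blast
  ultimately show ?thesis
    unfolding smooth_def by metis
qed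

lemma smooth_linear_combination:
  assumes "smooth f" "smooth g"
  shows "smooth (\<lambda>t. \<alpha> * f t + \<beta> * g t)"
proof -
  have d: "((deriv ^^ n) h has_real_derivative (deriv ^^ Suc n) h t) (at t)" if "smooth h" for h n t
    using that by (simp add: smooth_def DERIV_deriv_iff_real_differentiable)
  have d2: "((\<lambda>t. \<alpha> * (deriv ^^ n) f t + \<beta> * (deriv ^^ n) g t) has_real_derivative
         \<alpha> * (deriv ^^ Suc n) f t + \<beta> * (deriv ^^ Suc n) g t) (at t)" for n t
    by (intro derivative_intros DERIV_cmult d assms)
  have "(deriv ^^ n) (\<lambda>t. \<alpha> * f t + \<beta> * g t) = (\<lambda>t. \<alpha> * (deriv ^^ n) f t + \<beta> * (deriv ^^ n) g t)" for n
  proof (induction n)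
    case (Suc n)
    have "(deriv ^^ Suc n) (\<lambda>t. \<alpha> * f t + \<beta> * g t) = deriv (\<lambda>t. \<alpha> * (deriv ^^ n) f t + \<beta> * (deriv ^^ n) g t)"
      by (simp only: funpow.simps o_apply Suc)
    also have "\<dots> = (\<lambda>t. \<alpha> * (deriv ^^ Suc n) f t + \<beta> * (deriv ^^ Suc n) g t)"
      by (rule ext) (rule DERIV_imp_deriv[OF d2])
    finally show ?case .
  qed simp
  moreover have "(\<lambda>t. \<alpha> * (deriv ^^ n) f t + \<beta> * (deriv ^^ n) g t) differentiable at t" for n t
    using d2 unfolding real_differentiable_def by blast
  ultimately show ?thesis unfolding smooth_def by simp
qed

lemma smooth_if_smooth_derivative:
  assumes "smooth \<psi>" "\<And>t. (\<phi> has_real_derivative \<psi> t) (at t)"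
  shows "smooth \<phi>"
  unfolding smooth_def
proof (intro allI)
  fix n t
  have "deriv \<phi> = \<psi>" by (rule ext) (rule DERIV_imp_deriv[OF assms(2)])
  then show "(deriv ^^ n) \<phi> differentiable at t"
  proof (cases n)
    case 0
    then show ?thesis using assms(2) unfolding real_differentiable_def by auto
  next
    case (Suc m)
    have "(deriv ^^ n) \<phi> = (deriv ^^ m) \<psi>"
      by (simp only: Suc funpow_Suc_right o_apply \<open>deriv \<phi> = \<psi>\<close>)
    then show ?thesis using assms(1) unfolding smooth_def by simp
  qed
qed

text \<open>
  A smooth function that is positive exactly on \<open>(a, b)\<close> if \<open>a < b\<close>. As \<open>s\<close> tends to 0, it increases
  to the indicator function of this interval.
\<close>

definition bump :: "real \<Rightarrow> real \<Rightarrow> real \<Rightarrow> real \<Rightarrow> real" where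
  "bump s a b t = flat s 0 ((t - a) * (b - t))"

lemma smooth_bump: "s > 0 \<Longrightarrow> smooth (bump s a b)"
  using smooth_poly_flat[of s 1 0 "[:- a * b, a + b, - 1:]"]
  by (simp add: bump_def[abs_def] algebra_simps)

lemma continuous_on_bump: "s > 0 \<Longrightarrow> continuous_on S (bump s a b)"
  using smooth_bump[of s a b] unfolding smooth_def
  by (metis continuous_at_imp_continuous_on differentiable_imp_continuous_within funpow_0)

lemma bump_pos_iff: "a < b \<Longrightarrow> bump s a b t > 0 \<longleftrightarrow> a < t \<and> t < b"
  by (auto simp: bump_def flat_def zero_less_mult_iff)

lemma bump_nonneg: "0 \<le> bump s a b t"
  by (auto simp: bump_def flat_def)

lemma bump_eq_0_iff: "a < b \<Longrightarrow> bump s a b t = 0 \<longleftrightarrow> t \<le> a \<or> b \<le> t"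
  using bump_pos_iff[of a b s t] bump_nonneg[of s a b t] by auto

lemma bump_eq_0: "a < b \<Longrightarrow> t \<le> a \<or> b \<le> t \<Longrightarrow> bump s a b t = 0"
  by (simp add: bump_eq_0_iff)

lemma bump_le_1: "s > 0 \<Longrightarrow> bump s a b t \<le> 1"
  by (auto simp: bump_def flat_def)

lemma bump_tendsto_1:
  assumes "a < t" "t < b"
  shows "(\<lambda>n. bump (1 / real (Suc n)) a b t) \<longlonglongrightarrow> 1"
proof -
  let ?y = "(t - a) * (b - t)"
  have "(\<lambda>n. exp (- (1 / real (Suc n)) / ?y)) \<longlonglongrightarrow> exp (- 0 / ?y)"
    using assms LIMSEQ_inverse_real_of_nat by (intro tendsto_intros) (auto simp: inverse_eq_divide)
  then show ?thesis using assms by (simp add: bump_def flat_def)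
qed

definition bump_mass :: "real \<Rightarrow> real \<Rightarrow> real \<Rightarrow> real" where
  "bump_mass s a b = integral {a..b} (bump s a b)"

lemma bump_mass_pos:
  assumes "s > 0" "a < b"
  shows "bump_mass s a b > 0"
proof -
  have "0 \<le> bump_mass s a b" unfolding bump_mass_def
    by (intro Henstock_Kurzweil_Integration.integral_nonneg integrable_continuous_real continuous_on_bump assms) (simp add: bump_nonneg)
  moreover have "bump_mass s a b \<noteq> 0"
  proof
    assume "bump_mass s a b = 0"
    then have "\<forall>t\<in>{a..b}. bump s a b t = 0"
      using integral_eq_0_iff[of a b "bump s a b"] assms
      by (simp add: bump_mass_def continuous_on_bump bump_nonneg)
    then show False using assms bump_pos_iff[of a b s "(a + b) / 2"] by force
  qed
  ultimately show ?thesis by simp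
qed

lemma integral_eq_on_support:
  fixes f :: "real \<Rightarrow> 'a::banach"
  assumes "x \<le> a" "b \<le> y" "\<And>t. t \<notin> {a..b} \<Longrightarrow> f t = 0"
  shows "integral {x..y} f = integral {a..b} f"
proof -
  have "{r \<in> {x..y} - {a..b}. f r \<noteq> 0} = {}" "{r \<in> {a..b} - {x..y}. f r \<noteq> 0} = {}"
    using assms by force+
  then show ?thesis by (intro integral_spike_set) (simp_all only: negligible_empty)
qed

text \<open>
  A combination of two bumps with total integral 0, so that its primitive has compact support. The
  second bump has the fixed parameter 1 because it serves as a reference for all the others.
\<close>

definition bump_pair :: "real \<Rightarrow> real \<Rightarrow> real \<Rightarrow> real \<Rightarrow> real \<Rightarrow> real \<Rightarrow> real" where
  "bump_pair s a b c d t = bump_mass 1 c d * bump s a b t - bump_mass s a b * bump 1 c d t"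

definition bump_pair_primitive :: "real \<Rightarrow> real \<Rightarrow> real \<Rightarrow> real \<Rightarrow> real \<Rightarrow> real \<Rightarrow> real" where
  "bump_pair_primitive s a b c d t = integral {0..t} (bump_pair s a b c d)"

lemma smooth_bump_pair: "s > 0 \<Longrightarrow> smooth (bump_pair s a b c d)"
  using smooth_linear_combination[OF smooth_bump smooth_bump[of 1], of s "bump_mass 1 c d" a b "- bump_mass s a b" c d]
  by (simp add: bump_pair_def[abs_def])

lemma continuous_on_bump_pair: "s > 0 \<Longrightarrow> continuous_on S (bump_pair s a b c d)"
  unfolding bump_pair_def[abs_def] by (intro continuous_intros continuous_on_bump) auto

lemma bump_pair_primitive_eq_0:
  assumes s: "s > 0" and ab: "0 < a" "a < b" and cd: "0 < c" "c < d"
    and t: "t \<notin> {min a c..max b d}"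
  shows "bump_pair_primitive s a b c d t = 0"
proof (cases "t < min a c")
  case True
  then have "integral {0..t} (bump_pair s a b c d) = integral {0..t} (\<lambda>_. 0)"
    by (intro Henstock_Kurzweil_Integration.integral_cong) (use ab cd in \<open>auto simp: bump_pair_def bump_eq_0\<close>)
  then show ?thesis by (simp add: bump_pair_primitive_def)
next
  case False
  then have "t \<ge> max b d" using t by auto
  then have "integral {0..t} (bump s a b) = bump_mass s a b" "integral {0..t} (bump 1 c d) = bump_mass 1 c d"
    unfolding bump_mass_def using ab cd by (auto intro!: integral_eq_on_support simp: bump_eq_0_iff)
  moreover have "integral {0..t} (bump_pair s a b c d)
      = bump_mass 1 c d * integral {0..t} (bump s a b) - bump_mass s a b * integral {0..t} (bump 1 c d)"
    unfolding bump_pair_def[abs_def] using s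
    by (subst Henstock_Kurzweil_Integration.integral_diff)
      (auto intro!: integrable_continuous_real continuous_intros continuous_on_bump)
  ultimately show ?thesis by (simp add: bump_pair_primitive_def)
qed

lemma bump_pair_primitive_derivative:
  assumes s: "s > 0" and ab: "0 < a" "a < b" and cd: "0 < c" "c < d"
  shows "(bump_pair_primitive s a b c d has_real_derivative bump_pair s a b c d t) (at t)"
proof (cases "t < min a c")
  case True
  have "((\<lambda>_. 0) has_real_derivative 0) (at t)" by simp
  then have "(bump_pair_primitive s a b c d has_real_derivative 0) (at t)"
  proof (rule has_field_derivative_transform_within_open)
    show "open {..<min a c}" "t \<in> {..<min a c}" using True by auto
    fix x assume "x \<in> {..<min a c}"
    then have "\<not> min a c \<le> x" by (simp only: lessThan_iff not_le)
    then have "x \<notin> {min a c..max b d}" by (simp only: atLeastAtMost_iff simp_thms)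
    then show "0 = bump_pair_primitive s a b c d x"
      by (rule bump_pair_primitive_eq_0[OF s ab cd, symmetric])
  qed
  moreover have "bump_pair s a b c d t = 0" using True ab cd by (auto simp: bump_pair_def bump_eq_0)
  ultimately show ?thesis by simp
next
  case False
  then have t: "t > 0" using ab cd by auto
  have "((\<lambda>u. integral {0..u} (bump_pair s a b c d)) has_real_derivative bump_pair s a b c d t) (at t within {0..t + 1})"
    using t by (intro integral_has_real_derivative continuous_on_bump_pair s) auto
  moreover have "at t within {0..t + 1} = at t" using t by (intro at_within_interior) simp
  ultimately show ?thesis by (simp only: bump_pair_primitive_def[abs_def])
qed

lemma test_function_bump_pair_primitive:
  assumes s: "s > 0" and ab: "0 < a" "a < b" "b < T" and cd: "0 < c" "c < d" "d < T"
  shows "test_function {0<..<T} (bump_pair_primitive s a b c d)"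
proof -
  let ?\<phi> = "bump_pair_primitive s a b c d"
  have sub: "closure {t. ?\<phi> t \<noteq> 0} \<subseteq> {min a c..max b d}"
    using bump_pair_primitive_eq_0[OF s ab(1,2) cd(1,2)] by (intro closure_minimal) blast+
  have "smooth ?\<phi>"
    by (rule smooth_if_smooth_derivative[OF smooth_bump_pair[OF s] bump_pair_primitive_derivative[OF s ab(1,2) cd(1,2)]])
  moreover have "compact (closure {t. ?\<phi> t \<noteq> 0})"
    using sub by (meson bounded_closed_interval bounded_subset closed_closure compact_eq_bounded_closed)
  moreover have "closure {t. ?\<phi> t \<noteq> 0} \<subseteq> {0<..<T}"
    by (rule order_trans[OF sub]) (use ab cd in \<open>simp add: subset_iff min_le_iff_disj le_max_iff_disj, auto\<close>)
  ultimately show ?thesis by (simp add: test_function_def smooth_def)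
qed

lemma test_function_bump:
  assumes s: "s > 0" and ab: "0 < a" "a < b" "b < T"
  shows "test_function {0<..<T} (bump s a b)"
proof -
  have sub: "closure {t. bump s a b t \<noteq> 0} \<subseteq> {a..b}"
    using ab by (intro closure_minimal) (auto simp: bump_eq_0_iff)
  have "compact (closure {t. bump s a b t \<noteq> 0})"
    using sub by (meson bounded_closed_interval bounded_subset closed_closure compact_eq_bounded_closed)
  moreover have "closure {t. bump s a b t \<noteq> 0} \<subseteq> {0<..<T}"
    by (rule order_trans[OF sub]) (use ab in auto)
  ultimately show ?thesis using smooth_bump[OF s] by (simp add: test_function_def smooth_def)
qed

section \<open>Weak derivatives of functions on an interval\<close>

text \<open>
  By Henstock's lemma, the sum of \<open>|K| |y x|\<close> over a fine tagged division differs little from the sum of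
  the norms of the integrals of \<open>y\<close> over the pieces \<open>K\<close>, all of which vanish. Hence \<open>|y|\<close> has
  integral 0.
\<close>

lemma AE_zero_if_interval_integrals_zero:
  fixes y :: "real \<Rightarrow> 'a::euclidean_space"
  assumes y: "y absolutely_integrable_on {a..b}"
    and zero: "\<And>c d. {c..d} \<subseteq> {a..b} \<Longrightarrow> integral {c..d} y = 0"
  shows "AE t in lebesgue_on {a..b}. y t = 0"
proof -
  have yi: "y integrable_on cbox a b"
    using y by (simp add: absolutely_integrable_on_def)
  have "((\<lambda>t. norm (y t)) has_integral 0) (cbox a b)"
    unfolding has_integral
  proof (intro allI impI)
    fix e :: real assume "e > 0"
    obtain \<gamma> where \<gamma>: "gauge \<gamma>"
      "\<And>p. \<lbrakk>p tagged_partial_division_of (cbox a b); \<gamma> fine p\<rbrakk> \<Longrightarrow>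
             sum (\<lambda>(x,k). norm(measure lborel k *\<^sub>R y x - integral k y)) p < e"
      using Henstock_lemma[OF yi \<open>e > 0\<close>] by blast
    show "\<exists>\<gamma>. gauge \<gamma> \<and> (\<forall>D. D tagged_division_of cbox a b \<and> \<gamma> fine D \<longrightarrow>
        norm ((\<Sum>(x,K)\<in>D. measure lborel K *\<^sub>R norm (y x)) - 0) < e)"
    proof (intro exI conjI allI impI)
      fix D assume D: "D tagged_division_of cbox a b \<and> \<gamma> fine D"
      have "(\<Sum>(x,K)\<in>D. measure lborel K *\<^sub>R norm (y x)) = (\<Sum>(x,K)\<in>D. norm (measure lborel K *\<^sub>R y x - integral K y))"
      proof (rule sum.cong[OF refl], clarify)
        fix x K assume xK: "(x, K) \<in> D"
        then obtain c d where K: "K = cbox c d" and "K \<subseteq> cbox a b"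
          using D tagged_division_ofD(3,4)[of D "cbox a b" x K] by blast
        then have "integral K y = 0" using zero[of c d] by simp
        then show "measure lborel K *\<^sub>R norm (y x) = norm (measure lborel K *\<^sub>R y x - integral K y)" by simp
      qed
      moreover have "\<dots> < e" using \<gamma>(2)[of D] D tagged_division_of_def by blast
      moreover have "0 \<le> (\<Sum>(x,K)\<in>D. measure lborel K *\<^sub>R norm (y x))" by (intro sum_nonneg) auto
      ultimately show "norm ((\<Sum>(x,K)\<in>D. measure lborel K *\<^sub>R norm (y x)) - 0) < e" by simp
    qed (rule \<gamma>(1))
  qed
  then have "integral {a..b} (\<lambda>t. norm (y t)) = 0" by (simp add: integral_unique)
  moreover have "integrable (lebesgue_on {a..b}) (\<lambda>t. norm (y t))"
    by (intro integrable_norm absolutely_integrable_imp_integrable y) simp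
  ultimately have "integral\<^sup>L (lebesgue_on {a..b}) (\<lambda>t. norm (y t)) = 0"
    by (simp add: lebesgue_integral_eq_integral)
  then have "AE t in lebesgue_on {a..b}. norm (y t) = 0"
    using \<open>integrable (lebesgue_on {a..b}) (\<lambda>t. norm (y t))\<close>
    by (subst integral_nonneg_eq_0_iff_AE[symmetric]) auto
  then show ?thesis by simp
qed

text \<open>
  Here \<open>v\<close> is merely integrable, so that its indefinite integral need not be differentiable everywhere.
\<close>

lemma integral_by_parts_indefinite_integral:
  fixes v :: "real \<Rightarrow> 'a::euclidean_space" and \<phi> \<psi> :: "real \<Rightarrow> real"
  assumes ab: "a \<le> b" and v: "v absolutely_integrable_on {a..b}"
    and \<psi>: "continuous_on {a..b} \<psi>"
    and \<phi>: "\<And>t. t \<in> {a..b} \<Longrightarrow> (\<phi> has_real_derivative \<psi> t) (at t within {a..b})"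
  shows "integral {a..b} (\<lambda>t. \<psi> t *\<^sub>R integral {a..t} v) + integral {a..b} (\<lambda>t. \<phi> t *\<^sub>R v t)
           = \<phi> b *\<^sub>R integral {a..b} v"
proof -
  define V where "V t = integral {a..t} v" for t
  have vi: "v integrable_on {a..b}" and nvi: "(\<lambda>t. norm (v t)) integrable_on {a..b}"
    using v by (auto simp: absolutely_integrable_on_def)
  have Vc: "continuous_on {a..b} V"
    unfolding V_def by (rule indefinite_integral_continuous_1[OF vi])
  have \<phi>c: "continuous_on {a..b} \<phi>"
    using \<phi> by (rule DERIV_continuous_on)
  have i1: "(\<lambda>t. \<psi> t *\<^sub>R V t) integrable_on {a..b}"
    by (intro integrable_continuous_real continuous_intros \<psi> Vc)
  have i2: "(\<lambda>t. \<phi> t *\<^sub>R v t) integrable_on {a..b}"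
    using absolutely_integrable_continuous_scaleR[OF \<phi>c v] by (simp add: absolutely_integrable_on_def)
  have n\<psi>: "(\<lambda>t. \<bar>\<psi> t\<bar>) integrable_on {a..b}"
    by (intro integrable_continuous_real continuous_intros \<psi>)
  define \<Phi> where "\<Phi> t = \<phi> t *\<^sub>R V t - integral {a..t} (\<lambda>t. \<psi> t *\<^sub>R V t) - integral {a..t} (\<lambda>t. \<phi> t *\<^sub>R v t)" for t
  have "norm (\<Phi> b - \<Phi> a) \<le> integral {a..b} (\<lambda>_. 0)"
  proof (rule increment_le_integral_if_locally[OF ab, where k = "\<lambda>t. norm (v t) + \<bar>\<psi> t\<bar>"])
    show "(\<lambda>t. norm (v t) + \<bar>\<psi> t\<bar>) integrable_on {a..b}" by (intro integrable_add nvi n\<psi>)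
    fix e :: real assume e: "e > 0"
    obtain d1 where d1: "d1 > 0" "\<And>s t. s \<in> {a..b} \<Longrightarrow> t \<in> {a..b} \<Longrightarrow> \<bar>t - s\<bar> < d1 \<Longrightarrow> norm (\<phi> t - \<phi> s) < e"
      using uniform_continuity_on_interval[OF \<phi>c e] by metis
    obtain d2 where d2: "d2 > 0" "\<And>s t. s \<in> {a..b} \<Longrightarrow> t \<in> {a..b} \<Longrightarrow> \<bar>t - s\<bar> < d2 \<Longrightarrow> norm (V t - V s) < e"
      using uniform_continuity_on_interval[OF Vc e] by metis
    show "\<exists>d>0. \<forall>s t. a \<le> s \<and> s \<le> t \<and> t \<le> b \<and> t - s < d \<longrightarrow>
       norm (\<Phi> t - \<Phi> s) \<le> integral {s..t} (\<lambda>_. 0) + e * integral {s..t} (\<lambda>t. norm (v t) + \<bar>\<psi> t\<bar>)"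
    proof (intro exI conjI allI impI)
      fix s t assume st: "a \<le> s \<and> s \<le> t \<and> t \<le> b \<and> t - s < min d1 d2"
      have sub: "u integrable_on {s..t}" if "u integrable_on {a..b}" for u :: "real \<Rightarrow> 'c::banach"
        using integrable_subinterval_real[OF that] st by auto
      have comb: "integral {a..t} u - integral {a..s} u = integral {s..t} u" if "u integrable_on {a..b}" for u :: "real \<Rightarrow> 'a"
        using Henstock_Kurzweil_Integration.integral_combine[of a s t u] integrable_subinterval_real[OF that, of a t] st
        by (simp add: algebra_simps)
      have ch: "integral {s..t} \<psi> = \<phi> t - \<phi> s"
      proof (rule integral_unique, rule fundamental_theorem_of_calculus)
        fix x assume "x \<in> {s..t}"
        then show "(\<phi> has_vector_derivative \<psi> x) (at x within {s..t})"
          using st DERIV_subset[OF \<phi>, of x "{s..t}"] by (auto simp: has_real_derivative_iff_has_vector_derivative)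
      qed (use st in auto)
      have \<psi>s: "continuous_on {s..t} \<psi>" and Vs: "continuous_on {s..t} V" and \<phi>s: "continuous_on {s..t} \<phi>"
        using st by (auto intro: continuous_on_subset[OF \<psi>] continuous_on_subset[OF Vc] continuous_on_subset[OF \<phi>c])
      have vs: "v absolutely_integrable_on {s..t}"
        using st by (intro absolutely_integrable_on_subinterval[OF v]) auto
      have e1: "integral {s..t} (\<lambda>r. (\<phi> t - \<phi> r) *\<^sub>R v r) = \<phi> t *\<^sub>R (V t - V s) - integral {s..t} (\<lambda>t. \<phi> t *\<^sub>R v t)"
        unfolding scaleR_diff_left V_def comb[OF vi]
        by (subst Henstock_Kurzweil_Integration.integral_diff) (auto intro!: sub[OF i2] integrable_cmul sub[OF vi])
      have e2: "integral {s..t} (\<lambda>r. \<psi> r *\<^sub>R (V s - V r)) = (\<phi> t - \<phi> s) *\<^sub>R V s - integral {s..t} (\<lambda>r. \<psi> r *\<^sub>R V r)"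
      proof -
        have "integral {s..t} (\<lambda>r. \<psi> r *\<^sub>R V s) = (\<phi> t - \<phi> s) *\<^sub>R V s"
          using integral_linear[OF integrable_continuous_real[OF \<psi>s] bounded_linear_scaleR_left[of "V s"]] ch
          by (simp add: o_def)
        then show ?thesis unfolding scaleR_diff_right
          by (subst Henstock_Kurzweil_Integration.integral_diff)
            (auto intro!: integrable_continuous_real continuous_intros \<psi>s Vs)
      qed
      have "\<Phi> t - \<Phi> s = integral {s..t} (\<lambda>r. (\<phi> t - \<phi> r) *\<^sub>R v r) + integral {s..t} (\<lambda>r. \<psi> r *\<^sub>R (V s - V r))"
        unfolding e1 e2 \<Phi>_def comb[OF i1, symmetric] comb[OF i2, symmetric] by (simp add: algebra_simps)
      also have "norm \<dots> \<le> integral {s..t} (\<lambda>r. e * norm (v r)) + integral {s..t} (\<lambda>r. e * \<bar>\<psi> r\<bar>)"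
      proof (intro order_trans[OF norm_triangle_ineq] add_mono Henstock_Kurzweil_Integration.integral_norm_bound_integral)
        show "(\<lambda>r. (\<phi> t - \<phi> r) *\<^sub>R v r) integrable_on {s..t}"
          using absolutely_integrable_continuous_scaleR[OF _ vs, of "\<lambda>r. \<phi> t - \<phi> r"] \<phi>s
          by (simp add: absolutely_integrable_on_def continuous_intros)
        show "(\<lambda>r. \<psi> r *\<^sub>R (V s - V r)) integrable_on {s..t}"
          by (intro integrable_continuous_real continuous_intros \<psi>s Vs)
        show "(\<lambda>r. e * norm (v r)) integrable_on {s..t}" "(\<lambda>r. e * \<bar>\<psi> r\<bar>) integrable_on {s..t}"
          by (intro integrable_on_mult_right sub nvi n\<psi>)+
        fix r assume r: "r \<in> {s..t}"
        have "\<bar>\<phi> t - \<phi> r\<bar> \<le> e" using d1(2)[of r t] r st by auto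
        then show "norm ((\<phi> t - \<phi> r) *\<^sub>R v r) \<le> e * norm (v r)" by (simp add: mult_right_mono)
        have "norm (V s - V r) \<le> e" using d2(2)[of r s] r st by auto
        then show "norm (\<psi> r *\<^sub>R (V s - V r)) \<le> e * \<bar>\<psi> r\<bar>" by (simp add: mult_left_mono mult.commute[of e])
      qed
      also have "\<dots> = integral {s..t} (\<lambda>_. 0) + e * integral {s..t} (\<lambda>t. norm (v t) + \<bar>\<psi> t\<bar>)"
        using sub[OF nvi] sub[OF n\<psi>] by (simp add: Henstock_Kurzweil_Integration.integral_add distrib_left)
      finally show "norm (\<Phi> t - \<Phi> s) \<le> integral {s..t} (\<lambda>_. 0) + e * integral {s..t} (\<lambda>t. norm (v t) + \<bar>\<psi> t\<bar>)" .
    qed (use d1 d2 in auto)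
  qed (rule integrable_0)
  then show ?thesis by (simp add: \<Phi>_def V_def algebra_simps)
qed

text \<open>
  The defining identity of the weak derivative for one function of time and one test function.
\<close>

definition weak_deriv_against :: "real \<Rightarrow> (real \<Rightarrow> 'a::euclidean_space) \<Rightarrow> (real \<Rightarrow> 'a) \<Rightarrow> (real \<Rightarrow> real) \<Rightarrow> bool" where
  "weak_deriv_against T u v \<phi> \<longleftrightarrow>
     integrable (lebesgue_on {0..T}) (\<lambda>t. deriv \<phi> t *\<^sub>R u t) \<and>
     integrable (lebesgue_on {0..T}) (\<lambda>t. \<phi> t *\<^sub>R v t) \<and>
     (\<integral>t. deriv \<phi> t *\<^sub>R u t \<partial>lebesgue_on {0..T}) = - (\<integral>t. \<phi> t *\<^sub>R v t \<partial>lebesgue_on {0..T})"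

lemma AE_lebesgue_on_inner_intervals:
  fixes T :: real
  assumes "\<And>a b. a \<in> \<rat> \<Longrightarrow> b \<in> \<rat> \<Longrightarrow> 0 < a \<Longrightarrow> a < b \<Longrightarrow> b < T \<Longrightarrow> AE t in lebesgue_on {a..b}. P t"
  shows "AE t in lebesgue_on {0..T}. P t"
proof -
  have *: "AE t in lebesgue. 0 < a \<and> a < b \<and> b < T \<longrightarrow> t \<in> {a..b} \<longrightarrow> P t" if "a \<in> \<rat>" "b \<in> \<rat>" for a b
  proof (cases "0 < a \<and> a < b \<and> b < T")
    case True
    then have "AE t in lebesgue_on {a..b}. P t" using assms that by auto
    then have "AE t in lebesgue. t \<in> {a..b} \<longrightarrow> P t" by (simp add: AE_restrict_space_iff)
    then show ?thesis by (rule AE_mp) auto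
  qed auto
  have "AE t in lebesgue. \<forall>a\<in>\<rat>. \<forall>b\<in>\<rat>. 0 < a \<and> a < b \<and> b < T \<longrightarrow> t \<in> {a..b} \<longrightarrow> P t"
    using * by (auto simp: AE_ball_countable[OF countable_rat])
  moreover have "AE t in lebesgue. t \<noteq> 0" "AE t in lebesgue. t \<noteq> T"
    by (intro AE_completion AE_lborel_singleton)+
  ultimately have "AE t in lebesgue. t \<in> {0..T} \<longrightarrow> P t"
  proof eventually_elim
    case (elim t)
    show ?case
    proof
      assume "t \<in> {0..T}"
      then have t: "0 < t" "t < T" using elim by auto
      obtain a where "a \<in> \<rat>" "0 < a" "a < t" using Rats_dense_in_real[OF t(1)] by auto
      moreover obtain b where "b \<in> \<rat>" "t < b" "b < T" using Rats_dense_in_real[OF t(2)] by auto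
      ultimately show "P t" using elim(1) by force
    qed
  qed
  then show ?thesis by (simp add: AE_restrict_space_iff)
qed

lemma integral_zero_if_zero_on_rationals:
  fixes y :: "real \<Rightarrow> 'a::euclidean_space"
  assumes y: "y integrable_on {a..b}" and a: "a \<in> \<rat>" 
    and zero: "\<And>d. d \<in> \<rat> \<Longrightarrow> a < d \<Longrightarrow> d < b \<Longrightarrow> integral {a..d} y = 0"
    and t: "a \<le> t" "t \<le> b"
  shows "integral {a..t} y = 0"
proof (cases "a = b")
  case True
  then show ?thesis using t by simp
next
  case False
  then have ab: "a < b" using t by simp
  have cont: "continuous_on {a..b} (\<lambda>t. integral {a..t} y)"
    by (rule indefinite_integral_continuous_1[OF y])
  show ?thesis
  proof (rule continuous_constant_on_closure[where S = "\<rat> \<inter> {a<..<b}" and x = t])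
    have cl: "closure (\<rat> \<inter> {a<..<b}) = {a..b}"
      using closure_open_Int_superset[of "{a<..<b}" "\<rat>"] ab by (simp add: Rats_closure_real Int_commute)
    show "continuous_on (closure (\<rat> \<inter> {a<..<b})) (\<lambda>t. integral {a..t} y)" using cont cl by simp
    show "t \<in> closure (\<rat> \<inter> {a<..<b})" using cl t by simp
    show "integral {a..x} y = 0" if "x \<in> \<rat> \<inter> {a<..<b}" for x using that zero by auto
  qed
qed

lemma bump_integral_tendsto:
  fixes y :: "real \<Rightarrow> 'a::euclidean_space"
  assumes y: "y absolutely_integrable_on {a..b}" and "a < b"
  shows "(\<lambda>n. integral {a..b} (\<lambda>t. bump (1 / real (Suc n)) a b t *\<^sub>R y t)) \<longlonglongrightarrow> integral {a..b} y"
proof -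
  have "(\<lambda>n. integral {a<..<b} (\<lambda>t. bump (1 / real (Suc n)) a b t *\<^sub>R y t)) \<longlonglongrightarrow> integral {a<..<b} y"
  proof (rule dominated_convergence(2)[where h = "\<lambda>t. norm (y t)"])
    show "(\<lambda>t. norm (y t)) integrable_on {a<..<b}"
      using y by (simp add: absolutely_integrable_on_def integrable_on_open_interval_real)
    show "(\<lambda>t. bump (1 / real (Suc n)) a b t *\<^sub>R y t) integrable_on {a<..<b}" for n
      using absolutely_integrable_continuous_scaleR[OF continuous_on_bump y, of "1 / real (Suc n)" a b]
      by (simp add: absolutely_integrable_on_def integrable_on_open_interval_real)
    show "norm (bump (1 / real (Suc n)) a b t *\<^sub>R y t) \<le> norm (y t)" for n t
      using bump_le_1[of "1 / real (Suc n)" a b t] bump_nonneg[of "1 / real (Suc n)" a b t]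
      by (simp add: mult_left_le_one_le)
    show "(\<lambda>n. bump (1 / real (Suc n)) a b t *\<^sub>R y t) \<longlonglongrightarrow> y t" if "t \<in> {a<..<b}" for t
      using tendsto_scaleR[OF bump_tendsto_1 tendsto_const, of a t b "y t"] that by simp
  qed
  then show ?thesis by (simp add: integral_open_interval_real)
qed

text \<open>
  The lemma of du Bois-Reymond, with countably many test functions. Let \<open>z\<close> be the difference of \<open>u\<close>
  and the indefinite integral of \<open>v\<close>; its weak derivative is 0. Testing with the primitive of a
  balanced pair of bumps says that the mean of \<open>z\<close> with respect to a bump is the same for all
  bumps. Letting the bumps sharpen to indicator functions, \<open>z\<close> has the same mean on all rational
  intervals, so it is constant almost everywhere.
\<close>

lemma weak_derivative_indefinite_integral:
  fixes u v :: "real \<Rightarrow> 'a::euclidean_space"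
  assumes T: "T > 0"
    and u: "\<And>a b. a \<in> \<rat> \<Longrightarrow> b \<in> \<rat> \<Longrightarrow> 0 < a \<Longrightarrow> a < b \<Longrightarrow> b < T \<Longrightarrow> u absolutely_integrable_on {a..b}"
    and v: "v absolutely_integrable_on {0..T}"
    and weak: "\<And>a b c d n. a \<in> \<rat> \<Longrightarrow> b \<in> \<rat> \<Longrightarrow> 0 < a \<Longrightarrow> a < b \<Longrightarrow> b < T
      \<Longrightarrow> c \<in> \<rat> \<Longrightarrow> d \<in> \<rat> \<Longrightarrow> 0 < c \<Longrightarrow> c < d \<Longrightarrow> d < T
      \<Longrightarrow> weak_deriv_against T u v (bump_pair_primitive (1 / real (Suc n)) a b c d)"
  shows "\<exists>C. AE t in lebesgue_on {0..T}. u t = C + integral {0..t} v"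
proof -
  define V where "V t = integral {0..t} v" for t
  define z where "z t = u t - V t" for t
  have vi: "v integrable_on {0..T}" using v by (simp add: absolutely_integrable_on_def)
  have Vc: "continuous_on {0..T} V"
    unfolding V_def by (rule indefinite_integral_continuous_1[OF vi])
  have zi: "z absolutely_integrable_on {a..b}" if "a \<in> \<rat>" "b \<in> \<rat>" "0 < a" "a < b" "b < T" for a b
    unfolding z_def[abs_def] using that
    by (intro set_integral_diff u absolutely_integrable_continuous_real continuous_on_subset[OF Vc]) auto
  obtain c where c: "c \<in> \<rat>" "0 < c" "c < T" using Rats_dense_in_real[OF T] by auto
  obtain d where d: "d \<in> \<rat>" "c < d" "d < T" using Rats_dense_in_real[OF c(3)] by auto
  define C where "C = (1 / bump_mass 1 c d) *\<^sub>R integral {c..d} (\<lambda>t. bump 1 c d t *\<^sub>R z t)"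
  have bump_int: "integral {a..b} (\<lambda>t. bump s a b t *\<^sub>R z t) = bump_mass s a b *\<^sub>R C"
    if ab: "a \<in> \<rat>" "b \<in> \<rat>" "0 < a" "a < b" "b < T" and s: "s = 1 / real (Suc n)" for a b s n
  proof -
    have s0: "s > 0" using s by simp
    let ?\<phi> = "bump_pair_primitive s a b c d" and ?\<psi> = "bump_pair s a b c d"
    have der: "(?\<phi> has_real_derivative ?\<psi> t) (at t)" for t
      by (rule bump_pair_primitive_derivative[OF s0 ab(3,4) c(2) d(2)])
    have d\<phi>: "deriv ?\<phi> = ?\<psi>" by (rule ext) (rule DERIV_imp_deriv[OF der])
    have w: "weak_deriv_against T u v ?\<phi>" unfolding s by (rule weak) (use ab c d in auto)
    note w = w[unfolded weak_deriv_against_def d\<phi>]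
    have eu: "integral {0..T} (\<lambda>t. ?\<psi> t *\<^sub>R u t) = - integral {0..T} (\<lambda>t. ?\<phi> t *\<^sub>R v t)"
      using w lebesgue_integral_eq_integral[OF conjunct1[OF w]]
        lebesgue_integral_eq_integral[OF conjunct1[OF conjunct2[OF w]]] by simp
    have iu: "(\<lambda>t. ?\<psi> t *\<^sub>R u t) integrable_on {0..T}"
      using integrable_on_lebesgue_on[OF conjunct1[OF w]] by simp
    have "integral {0..T} (\<lambda>t. ?\<psi> t *\<^sub>R integral {0..t} v) + integral {0..T} (\<lambda>t. ?\<phi> t *\<^sub>R v t)
      = ?\<phi> T *\<^sub>R integral {0..T} v"
      using T by (intro integral_by_parts_indefinite_integral v continuous_on_bump_pair s0
          has_field_derivative_at_within[OF der]) auto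
    also have "?\<phi> T = 0" by (rule bump_pair_primitive_eq_0) (use s0 ab c d in auto)
    finally have eV: "integral {0..T} (\<lambda>t. ?\<psi> t *\<^sub>R V t) = - integral {0..T} (\<lambda>t. ?\<phi> t *\<^sub>R v t)"
      by (simp add: V_def eq_neg_iff_add_eq_0)
    have iV: "(\<lambda>t. ?\<psi> t *\<^sub>R V t) integrable_on {0..T}"
      by (intro integrable_continuous_real continuous_intros continuous_on_bump_pair s0 Vc)
    have "integral {0..T} (\<lambda>t. ?\<psi> t *\<^sub>R z t) = 0"
      unfolding z_def scaleR_diff_right using iu iV eu eV
      by (simp add: Henstock_Kurzweil_Integration.integral_diff)
    moreover have "((\<lambda>t. ?\<psi> t *\<^sub>R z t) has_integral
       (bump_mass 1 c d *\<^sub>R integral {a..b} (\<lambda>t. bump s a b t *\<^sub>R z t)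
        - bump_mass s a b *\<^sub>R integral {c..d} (\<lambda>t. bump 1 c d t *\<^sub>R z t))) {0..T}"
    proof -
      have *: "((\<lambda>t. bump r x y t *\<^sub>R z t) has_integral integral {x..y} (\<lambda>t. bump r x y t *\<^sub>R z t)) {0..T}"
        if "x \<in> \<rat>" "y \<in> \<rat>" "0 < x" "x < y" "y < T" "r > 0" for r x y
      proof (rule has_integral_on_superset[of _ _ "{x..y}"])
        have "(\<lambda>t. bump r x y t *\<^sub>R z t) absolutely_integrable_on {x..y}"
          using that by (intro absolutely_integrable_continuous_scaleR continuous_on_bump zi)
        then show "((\<lambda>t. bump r x y t *\<^sub>R z t) has_integral integral {x..y} (\<lambda>t. bump r x y t *\<^sub>R z t)) {x..y}"
          by (simp add: absolutely_integrable_on_def integrable_integral)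
      qed (use that in \<open>auto simp: bump_eq_0\<close>)
      have \<psi>z: "?\<psi> t *\<^sub>R z t = bump_mass 1 c d *\<^sub>R (bump s a b t *\<^sub>R z t) - bump_mass s a b *\<^sub>R (bump 1 c d t *\<^sub>R z t)" for t
        by (simp add: bump_pair_def algebra_simps)
      show ?thesis
        unfolding \<psi>z by (intro has_integral_diff has_integral_cmul * ab s0 c d) simp
    qed
    ultimately have "bump_mass 1 c d *\<^sub>R integral {a..b} (\<lambda>t. bump s a b t *\<^sub>R z t)
        = bump_mass s a b *\<^sub>R integral {c..d} (\<lambda>t. bump 1 c d t *\<^sub>R z t)"
      by (simp add: integral_unique)
    then have "(1 / bump_mass 1 c d) *\<^sub>R (bump_mass 1 c d *\<^sub>R integral {a..b} (\<lambda>t. bump s a b t *\<^sub>R z t)) = bump_mass s a b *\<^sub>R C"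
      unfolding C_def by simp
    then show ?thesis using bump_mass_pos[OF zero_less_one d(2)] by simp
  qed
  \<comment> \<open>Passing to the limit in \<open>bump_int\<close> replaces the bump by the indicator of \<open>(a,b)\<close>.\<close>
  have zC: "integral {a..b} (\<lambda>t. z t - C) = 0"
    if ab: "a \<in> \<rat>" "b \<in> \<rat>" "0 < a" "a < b" "b < T" for a b
  proof -
    have l1: "(\<lambda>n. bump_mass (1 / real (Suc n)) a b *\<^sub>R C) \<longlonglongrightarrow> integral {a..b} z"
      using bump_integral_tendsto[OF zi[OF ab] ab(4)] bump_int[OF ab refl] by simp
    have "(\<lambda>n. bump_mass (1 / real (Suc n)) a b) \<longlonglongrightarrow> integral {a..b} (\<lambda>t. 1)"
      using bump_integral_tendsto[where y = "\<lambda>t. 1::real" and a = a and b = b] ab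
      by (simp add: bump_mass_def absolutely_integrable_continuous_real)
    then have l2: "(\<lambda>n. bump_mass (1 / real (Suc n)) a b *\<^sub>R C) \<longlonglongrightarrow> (b - a) *\<^sub>R C"
      using ab by (intro tendsto_intros) (simp add: integral_const_real)
    have "integral {a..b} z = (b - a) *\<^sub>R C" by (rule LIMSEQ_unique[OF l1 l2])
    then show ?thesis using zi[OF ab] ab
      by (subst Henstock_Kurzweil_Integration.integral_diff) (auto simp: absolutely_integrable_on_def)
  qed
  have "AE t in lebesgue_on {0..T}. z t - C = 0"
  proof (rule AE_lebesgue_on_inner_intervals, rule AE_zero_if_interval_integrals_zero)
    fix a b assume ab: "a \<in> \<rat>" "b \<in> \<rat>" "0 < a" "a < b" "b < T"
    show abs: "(\<lambda>t. z t - C) absolutely_integrable_on {a..b}"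
      using zi[OF ab] by (intro set_integral_diff) (auto intro: absolutely_integrable_continuous_real)
    then have int: "(\<lambda>t. z t - C) integrable_on {a..b}" by (simp add: absolutely_integrable_on_def)
    have ini: "integral {a..t} (\<lambda>t. z t - C) = 0" if "a \<le> t" "t \<le> b" for t
      by (rule integral_zero_if_zero_on_rationals[OF int ab(1) _ that]) (use zC ab in auto)
    fix x y assume xy: "{x..y} \<subseteq> {a..b}"
    show "integral {x..y} (\<lambda>t. z t - C) = 0"
    proof (cases "x \<le> y")
      case True
      then have "a \<le> x" "y \<le> b" using xy by auto
      then show ?thesis
        using Henstock_Kurzweil_Integration.integral_combine[of a x y "\<lambda>t. z t - C"] True ini[of x] ini[of y]
          integrable_subinterval_real[OF int, of a y] by auto
    qed simp
  qed
  then have "AE t in lebesgue_on {0..T}. u t = C + integral {0..t} v"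
    by (rule AE_mp) (auto simp: z_def V_def algebra_simps)
  then show ?thesis by blast
qed

section \<open>Slices at fixed points of space\<close>

lemma integrable_if_power_integrable:
  fixes u :: "real \<Rightarrow> 'a::euclidean_space"
  assumes u: "u \<in> borel_measurable (lebesgue_on {a..b})"
    and int: "integrable (lebesgue_on {a..b}) (\<lambda>t. norm (u t) ^ k)" and k: "k > 0"
  shows "u absolutely_integrable_on {a..b}"
proof -
  have "finite_measure (lebesgue_on {a..b})"
    by (rule finite_measure_lebesgue_on) (auto intro: lmeasurable_interval)
  then have 1: "integrable (lebesgue_on {a..b}) (\<lambda>t. 1 + norm (u t) ^ k)"
    using int by (intro Bochner_Integration.integrable_add finite_measure.integrable_const)
  have "integrable (lebesgue_on {a..b}) u"
  proof (rule Bochner_Integration.integrable_bound[OF 1 u], rule AE_I2)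
    fix t
    show "norm (u t) \<le> norm (1 + norm (u t) ^ k)"
    proof -
      have "norm (u t) \<le> 1 \<or> norm (u t) \<le> norm (u t) ^ k" using k self_le_power[of "norm (u t)" k] by linarith
      moreover have "0 \<le> norm (u t) ^ k" by simp
      ultimately show ?thesis unfolding real_norm_def by linarith
    qed
  qed
  then show ?thesis
    by (simp add: absolutely_integrable_on_def integrable_restrict_space set_integrable_def)
qed

text \<open>
  Functions that agree almost everywhere agree at points arbitrarily close to 0. This identifies the
  value at time 0 that \<open>initial_trace\<close> prescribes with the value of the continuous
  representative.
\<close>

lemma limits_equal_if_AE_equal:
  fixes g h :: "real \<Rightarrow> 'a::euclidean_space"
  assumes T: "T > 0" and ae: "AE t in lebesgue_on {0..T}. g t = h t"
    and g: "(g \<longlongrightarrow> c) (at_right 0)" and h: "(h \<longlongrightarrow> d) (at_right 0)"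
  shows "c = d"
proof (rule ccontr)
  assume "c \<noteq> d"
  have "((\<lambda>t. g t - h t) \<longlongrightarrow> c - d) (at_right 0)" by (intro tendsto_diff g h)
  then have "\<forall>\<^sub>F t in at_right 0. g t - h t \<noteq> 0"
    using \<open>c \<noteq> d\<close> by (intro tendsto_imp_eventually_ne) auto
  then obtain b where b: "b > 0" "\<And>t. 0 < t \<Longrightarrow> t < b \<Longrightarrow> g t \<noteq> h t"
    unfolding eventually_at_right_field by auto
  have "AE t in lebesgue. t \<in> {0..T} \<longrightarrow> g t = h t" using ae by (simp add: AE_restrict_space_iff)
  then have "AE t in lebesgue. t \<notin> {0<..<min b T}"
    by (rule AE_mp) (use b in \<open>auto intro!: AE_I2\<close>)
  then have "{0<..<min b T} \<in> null_sets lebesgue"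
    by (subst AE_iff_null_sets) auto
  then have "emeasure lebesgue {0<..<min b T} = 0" by auto
  then show False using b(1) T by (simp add: emeasure_lborel_Ioo)
qed

text \<open>
  The interpolation inequality for the time slices at one point of space, which are known only up to
  null sets and through weak derivatives. The hypothesis \<open>loc\<close> makes \<open>u1\<close> locally integrable, which is
  needed to treat it as a function with weak derivative \<open>u2\<close>; its integrability on all of \<open>[0,T]\<close> is
  a consequence.
\<close>

lemma slice_interpolation:
  fixes u0 u1 u2 :: "real \<Rightarrow> 'a::euclidean_space"
  assumes T: "T > 0"
    and m0: "u0 \<in> borel_measurable (lebesgue_on {0..T})" and m1: "u1 \<in> borel_measurable (lebesgue_on {0..T})"
    and m2: "u2 \<in> borel_measurable (lebesgue_on {0..T})"
    and i0: "integrable (lebesgue_on {0..T}) (\<lambda>t. norm (u0 t) ^ 6)"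
    and i2: "integrable (lebesgue_on {0..T}) (\<lambda>t. norm (u2 t) ^ 2)"
    and weak: "\<And>a b c d n. a \<in> \<rat> \<Longrightarrow> b \<in> \<rat> \<Longrightarrow> 0 < a \<Longrightarrow> a < b \<Longrightarrow> b < T
      \<Longrightarrow> c \<in> \<rat> \<Longrightarrow> d \<in> \<rat> \<Longrightarrow> 0 < c \<Longrightarrow> c < d \<Longrightarrow> d < T
      \<Longrightarrow> weak_deriv_against T u0 u1 (bump_pair_primitive (1 / real (Suc n)) a b c d)
        \<and> weak_deriv_against T u1 u2 (bump_pair_primitive (1 / real (Suc n)) a b c d)"
    and loc: "\<And>a b. a \<in> \<rat> \<Longrightarrow> b \<in> \<rat> \<Longrightarrow> 0 < a \<Longrightarrow> a < b \<Longrightarrow> b < T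
      \<Longrightarrow> integrable (lebesgue_on {0..T}) (\<lambda>t. bump 1 a b t *\<^sub>R u1 t)"
    and trace: "AE t in lebesgue_on {0..T}. g t = u1 t" "(g \<longlongrightarrow> c) (at_right 0)"
    and l: "l > 0"
  shows "integrable (lebesgue_on {0..T}) (\<lambda>t. norm (u1 t) ^ 3)"
    and "(\<integral>t. norm (u1 t) ^ 3 \<partial>lebesgue_on {0..T}) \<le> 8 * T * norm c ^ 3
        + 2 ^ 9 * ((\<integral>t. norm (u0 t) ^ 6 \<partial>lebesgue_on {0..T}) / l ^ 3
                   + l * (\<integral>t. norm (u2 t) ^ 2 \<partial>lebesgue_on {0..T}))"
proof -
  let ?M = "lebesgue_on {0..T}"
  have a2: "u2 absolutely_integrable_on {0..T}" by (rule integrable_if_power_integrable[OF m2 i2]) simp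
  have a0: "u0 absolutely_integrable_on {0..T}" by (rule integrable_if_power_integrable[OF m0 i0]) simp
  have a1loc: "u1 absolutely_integrable_on {a..b}" if ab: "a \<in> \<rat>" "b \<in> \<rat>" "0 < a" "a < b" "b < T" for a b
  proof -
    \<comment> \<open>A bump on a slightly larger interval is bounded below on \<open>[a,b]\<close> and can be divided out.\<close>
    obtain a' where a': "a' \<in> \<rat>" "0 < a'" "a' < a" using Rats_dense_in_real[OF ab(3)] by auto
    obtain b' where b': "b' \<in> \<rat>" "b < b'" "b' < T" using Rats_dense_in_real[OF ab(5)] by auto
    have "integrable (lebesgue_on {0..T}) (\<lambda>t. bump 1 a' b' t *\<^sub>R u1 t)"
      by (rule loc) (use a' b' ab in auto)
    then have "(\<lambda>t. bump 1 a' b' t *\<^sub>R u1 t) absolutely_integrable_on {0..T}"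
      by (simp add: absolutely_integrable_on_def integrable_restrict_space set_integrable_def)
    then have bu: "(\<lambda>t. bump 1 a' b' t *\<^sub>R u1 t) absolutely_integrable_on {a..b}"
      by (rule absolutely_integrable_on_subinterval) (use ab in auto)
    have pos: "bump 1 a' b' t > 0" if "t \<in> {a..b}" for t
      using bump_pos_iff[of a' b' 1 t] a' b' ab that by auto
    have "(\<lambda>t. (1 / bump 1 a' b' t) *\<^sub>R (bump 1 a' b' t *\<^sub>R u1 t)) absolutely_integrable_on {a..b}"
      using pos by (intro absolutely_integrable_continuous_scaleR bu continuous_intros continuous_on_bump) force+
    then show ?thesis
      by (rule set_integrable_cong[THEN iffD1, OF refl refl, rotated]) (use pos in force)
  qed
  obtain C where C: "AE t in ?M. u1 t = C + integral {0..t} u2"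
    using weak_derivative_indefinite_integral[OF T a1loc a2] weak by blast
  define w where "w t = C + integral {0..t} u2" for t
  have wc: "continuous_on {0..T} w"
    unfolding w_def[abs_def] using a2
    by (intro continuous_intros indefinite_integral_continuous_1) (simp add: absolutely_integrable_on_def)
  have ae1: "AE t in ?M. u1 t = w t" using C by (simp add: w_def)
  have "integrable ?M w"
    by (intro absolutely_integrable_imp_integrable absolutely_integrable_continuous_real wc) auto
  then have "integrable ?M u1"
    by (rule integrable_cong_AE_imp) (use m1 ae1 in auto)
  then have a1: "u1 absolutely_integrable_on {0..T}"
    by (simp add: absolutely_integrable_on_def integrable_restrict_space set_integrable_def)
  obtain D where D: "AE t in ?M. u0 t = D + integral {0..t} u1"
    using weak_derivative_indefinite_integral[OF T _ a1, of u0] weak absolutely_integrable_on_subinterval[OF a0]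
    by force
  define f where "f t = D + integral {0..t} w" for t
  have u1w: "integral {0..t} u1 = integral {0..t} w" if "t \<in> {0..T}" for t
  proof -
    have "AE s in lebesgue. s \<in> {0..T} \<longrightarrow> u1 s = w s" using ae1 by (simp add: AE_restrict_space_iff)
    then have "negligible {s. \<not> (s \<in> {0..T} \<longrightarrow> u1 s = w s)}"
      by (simp add: AE_iff_null_sets[symmetric] negligible_iff_null_sets eventually_ae_filter)
        (auto simp: completion.complete2 dest: null_sets_subset)
    then show ?thesis
      by (rule integral_spike[symmetric]) (use that in auto)
  qed
  have ae0: "AE t in ?M. u0 t = f t"
    using D AE_space by eventually_elim (simp add: f_def u1w)
  have fs: "f t - f s = integral {s..t} w" if "0 \<le> s" "s \<le> t" "t \<le> T" for s t
  proof -
    have "continuous_on {0..t} w" using that by (intro continuous_on_subset[OF wc]) auto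
    from Henstock_Kurzweil_Integration.integral_combine[OF _ _ integrable_continuous_real[OF this], of s] that
    show ?thesis unfolding f_def by (simp add: algebra_simps)
  qed
  have ws: "norm (w t - w s) \<le> integral {s..t} (\<lambda>r. norm (u2 r))" if "0 \<le> s" "s \<le> t" "t \<le> T" for s t
  proof -
    have i: "u2 absolutely_integrable_on {0..t}" "u2 absolutely_integrable_on {s..t}"
      using that by (auto intro!: absolutely_integrable_on_subinterval[OF a2])
    then have "w t - w s = integral {s..t} u2"
      using Henstock_Kurzweil_Integration.integral_combine[of 0 s t u2] that
      by (simp add: w_def absolutely_integrable_on_def algebra_simps)
    then show ?thesis using i(2)
      by (auto simp: absolutely_integrable_on_def intro!: Henstock_Kurzweil_Integration.integral_norm_bound_integral)
  qed
  have "(w \<longlongrightarrow> w 0) (at_right 0)"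
  proof -
    have "(w \<longlongrightarrow> w 0) (at 0 within {0..T})" using wc T by (auto simp: continuous_on_def)
    then show ?thesis using T by (simp add: at_within_Icc_at_right)
  qed
  moreover have "AE t in ?M. g t = w t" using trace(1) ae1 by eventually_elim simp
  ultimately have "c = w 0" using limits_equal_if_AE_equal[OF T _ trace(2)] by blast
  have fc: "continuous_on {0..T} f"
    unfolding f_def[abs_def] by (intro continuous_intros indefinite_integral_continuous_1 integrable_continuous_real wc)
  have cw: "continuous_on {0..T} (\<lambda>t. norm (w t) ^ 3)" and cf: "continuous_on {0..T} (\<lambda>t. norm (f t) ^ 6)"
    by (intro continuous_intros wc fc)+
  have iw: "integrable ?M (\<lambda>t. norm (w t) ^ 3)" and "if": "integrable ?M (\<lambda>t. norm (f t) ^ 6)"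
    by (intro absolutely_integrable_imp_integrable absolutely_integrable_continuous_real cw cf; simp)+
  show i1: "integrable ?M (\<lambda>t. norm (u1 t) ^ 3)"
    by (rule integrable_cong_AE_imp[OF iw]) (use m1 ae1 in auto)
  have "(\<integral>t. norm (u1 t) ^ 3 \<partial>?M) = (\<integral>t. norm (w t) ^ 3 \<partial>?M)"
    by (rule integral_cong_AE) (use i1 iw ae1 in auto)
  also have "\<dots> = integral {0..T} (\<lambda>t. norm (w t) ^ 3)" (is "_ = ?X")
    by (rule lebesgue_integral_eq_integral[OF iw]) simp
  finally have X: "(\<integral>t. norm (u1 t) ^ 3 \<partial>?M) = ?X" .
  have "(\<integral>t. norm (u0 t) ^ 6 \<partial>?M) = (\<integral>t. norm (f t) ^ 6 \<partial>?M)"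
    by (rule integral_cong_AE) (use i0 "if" ae0 in auto)
  also have "\<dots> = integral {0..T} (\<lambda>t. norm (f t) ^ 6)" (is "_ = ?\<alpha>")
    by (rule lebesgue_integral_eq_integral[OF "if"]) simp
  finally have \<alpha>: "(\<integral>t. norm (u0 t) ^ 6 \<partial>?M) = ?\<alpha>" .
  have B: "(\<integral>t. norm (u2 t) ^ 2 \<partial>?M) = integral {0..T} (\<lambda>t. norm (u2 t) ^ 2)" (is "_ = ?B")
    by (rule lebesgue_integral_eq_integral[OF i2]) simp
  have nn: "0 \<le> ?\<alpha>" "0 \<le> ?B" unfolding \<alpha>[symmetric] B[symmetric] by auto
  have "?X \<le> 8 * T * norm (w 0) ^ 3 \<or> ?X ^ 4 \<le> 2 ^ 36 * (?\<alpha> * ?B ^ 3)"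
  proof (rule interpolation_on_interval[OF T wc fs _ _ _ ws])
    show "(\<lambda>r. norm (u2 r)) integrable_on {0..T}" using a2 by (simp add: absolutely_integrable_on_def)
    show "(\<lambda>t. norm (u2 t) ^ 2) integrable_on {0..T}" by (rule integrable_on_lebesgue_on[OF i2]) simp
  qed auto
  then have "?X \<le> 8 * T * norm (w 0) ^ 3 + 2 ^ 9 * (?\<alpha> / l ^ 3 + l * ?B)"
  proof
    assume "?X \<le> 8 * T * norm (w 0) ^ 3"
    moreover have "0 \<le> 2 ^ 9 * (?\<alpha> / l ^ 3 + l * ?B)" using nn l by simp
    ultimately show ?thesis by linarith
  next
    assume "?X ^ 4 \<le> 2 ^ 36 * (?\<alpha> * ?B ^ 3)"
    from le_weighted_sum_if_fourth_power_le[OF this nn l]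
    show ?thesis using T zero_le_power[OF norm_ge_zero, of "w 0" 3] by (simp add: add_increasing)
  qed
  then show "(\<integral>t. norm (u1 t) ^ 3 \<partial>?M) \<le> 8 * T * norm c ^ 3
        + 2 ^ 9 * ((\<integral>t. norm (u0 t) ^ 6 \<partial>?M) / l ^ 3 + l * (\<integral>t. norm (u2 t) ^ 2 \<partial>?M))"
    unfolding X \<alpha> B \<open>c = w 0\<close> .
qed

section \<open>Integration over space\<close>

lemma sigma_finite_lebesgue_on:
  assumes "S \<in> sets lebesgue"
  shows "sigma_finite_measure (lebesgue_on S :: 'a::euclidean_space measure)"
proof (rule sigma_finite_measure_restrict_space[OF _ assms])
  from sigma_finite_measure.sigma_finite_countable[OF sigma_finite_lborel]
  obtain A where "countable A" "A \<subseteq> sets lborel" "\<Union>A = space lborel" "\<forall>a\<in>A. emeasure (lborel :: 'a measure) a \<noteq> \<infinity>"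
    by auto
  then show "sigma_finite_measure (lebesgue :: 'a measure)"
    by (intro sigma_finite_measure.intro exI[of _ A]) (auto simp: subset_iff)
qed

text \<open>
  The essential supremum is at least 0, and not \<open>-\<infinity>\<close>, because \<open>[0,T]\<close> has positive measure. This is
  what makes its real part a bound.
\<close>

lemma nn_integral_powr_le_Linf_Lp_norm:
  assumes T: "T > 0" and p: "p > 0" and F: "in_Linf_Lp p T \<Omega> F"
  shows "0 \<le> Linf_Lp_norm p T \<Omega> F"
    and "AE t in lebesgue_on {0..T}. (\<integral>\<^sup>+x. ennreal (norm (F t x) powr p) \<partial>lebesgue_on \<Omega>)
           \<le> ennreal (Linf_Lp_norm p T \<Omega> F powr p)"
proof -
  let ?M = "lebesgue_on {0..T}" and ?N = "lebesgue_on \<Omega>"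
  let ?e = "Linf_Lp_esssup p T \<Omega> F"
  let ?K = "Linf_Lp_norm p T \<Omega> F"
  have fin: "?e < \<infinity>" and Lp: "AE t in ?M. in_Lp p ?N (F t)" using F by (auto simp: in_Linf_Lp_def)
  have le: "AE t in ?M. ereal (Lp_norm p ?N (F t)) \<le> ?e" unfolding Linf_Lp_esssup_def by (rule esssup_AE)
  have "\<not> (AE t in ?M. False)"
  proof
    assume "AE t in ?M. False"
    then have "emeasure ?M (space ?M) = 0" using ae_filter_eq_bot_iff[of ?M] by (simp add: trivial_limit_def)
    then show False using T by (simp add: emeasure_restrict_space)
  qed
  then obtain t where "ereal (Lp_norm p ?N (F t)) \<le> ?e" using le by (meson eventually_mono)
  then have "0 \<le> ?e" by (rule order_trans[rotated]) (simp add: Lp_norm_def)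
  then have e: "?e = ereal ?K" and K: "0 \<le> ?K" using fin unfolding Linf_Lp_norm_def
    by (auto simp: real_of_ereal_pos ereal_real)
  show "0 \<le> ?K" by (rule K)
  show "AE t in ?M. (\<integral>\<^sup>+x. ennreal (norm (F t x) powr p) \<partial>?N) \<le> ennreal (?K powr p)"
    using le Lp
  proof eventually_elim
    case (elim t)
    let ?I = "\<integral>x. norm (F t x) powr p \<partial>?N"
    have I0: "0 \<le> ?I" by simp
    have "?I powr (1 / p) \<le> ?K" using elim(1) unfolding e Lp_norm_def by simp
    then have "(?I powr (1 / p)) powr p \<le> ?K powr p" using p by (intro powr_mono2) auto
    then have "?I \<le> ?K powr p" using p I0 by (simp add: powr_powr)
    moreover have "(\<integral>\<^sup>+x. ennreal (norm (F t x) powr p) \<partial>?N) = ennreal ?I"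
      using elim(2) by (intro nn_integral_eq_integral) (auto simp: in_Lp_def)
    ultimately show ?case by (simp add: ennreal_leI)
  qed
qed

lemma iterated_nn_integral_le_Linf_Lp_norm:
  fixes F :: "real \<Rightarrow> real ^ 3 \<Rightarrow> 'a::euclidean_space"
  assumes T: "T > 0" and \<Omega>: "\<Omega> \<in> sets lebesgue" and n: "0 < n" and F: "in_Linf_Lp (real n) T \<Omega> F"
  shows "(\<integral>\<^sup>+x. \<integral>\<^sup>+t. ennreal (norm (F t x) ^ n) \<partial>lebesgue_on {0..T} \<partial>lebesgue_on \<Omega>)
           \<le> ennreal (T * Linf_Lp_norm (real n) T \<Omega> F ^ n)"
proof -
  let ?M = "lebesgue_on {0..T}" and ?N = "lebesgue_on \<Omega>"
  interpret M: sigma_finite_measure ?M by (rule sigma_finite_lebesgue_on) auto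
  interpret N: sigma_finite_measure ?N by (rule sigma_finite_lebesgue_on[OF \<Omega>])
  interpret MN: pair_sigma_finite ?M ?N ..
  have K: "0 \<le> Linf_Lp_norm (real n) T \<Omega> F" by (rule nn_integral_powr_le_Linf_Lp_norm(1)[OF T _ F]) (use n in simp)
  have pw: "y powr real n = y ^ n" if "0 \<le> y" for y :: real
    using n that by (cases "y = 0") (auto simp: powr_realpow)
  have "case_prod F \<in> borel_measurable (?M \<Otimes>\<^sub>M ?N)" using F by (simp add: in_Linf_Lp_def)
  then have "(\<lambda>(t, x). ennreal (norm (F t x) ^ n)) \<in> borel_measurable (?M \<Otimes>\<^sub>M ?N)"
    by (simp add: case_prod_unfold)
  then have "(\<integral>\<^sup>+x. \<integral>\<^sup>+t. ennreal (norm (F t x) ^ n) \<partial>?M \<partial>?N) = (\<integral>\<^sup>+t. \<integral>\<^sup>+x. ennreal (norm (F t x) ^ n) \<partial>?N \<partial>?M)"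
    using MN.Fubini'[of "\<lambda>t x. ennreal (norm (F t x) ^ n)"] by simp
  also have "\<dots> \<le> (\<integral>\<^sup>+t. ennreal (Linf_Lp_norm (real n) T \<Omega> F ^ n) \<partial>?M)"
    using nn_integral_powr_le_Linf_Lp_norm(2)[OF T _ F] n K
    by (intro nn_integral_mono_AE) (simp add: pw)
  also have "\<dots> = ennreal (T * Linf_Lp_norm (real n) T \<Omega> F ^ n)"
    using T K by (simp add: emeasure_restrict_space ennreal_mult mult.commute)
  finally show ?thesis .
qed

text \<open>
  Each test function has its own exceptional set of points \<open>x\<close>. The parameters are rational, so there
  are countably many of these sets and their union is again a null set.
\<close>

lemma AE_weak_deriv_against_all:
  fixes F G :: "real \<Rightarrow> real ^ 3 \<Rightarrow> 'a::euclidean_space"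
  assumes "weak_time_deriv T \<Omega> F G"
  shows "AE x in lebesgue_on \<Omega>. \<forall>a\<in>\<rat>. \<forall>b\<in>\<rat>. \<forall>c\<in>\<rat>. \<forall>d\<in>\<rat>. \<forall>n.
     0 < a \<and> a < b \<and> b < T \<and> 0 < c \<and> c < d \<and> d < T \<longrightarrow>
       weak_deriv_against T (\<lambda>t. F t x) (\<lambda>t. G t x) (bump_pair_primitive (1 / real (Suc n)) a b c d)"
proof -
  have "AE x in lebesgue_on \<Omega>. 0 < a \<and> a < b \<and> b < T \<and> 0 < c \<and> c < d \<and> d < T \<longrightarrow>
       weak_deriv_against T (\<lambda>t. F t x) (\<lambda>t. G t x) (bump_pair_primitive (1 / real (Suc n)) a b c d)" for a b c d n
  proof (cases "0 < a \<and> a < b \<and> b < T \<and> 0 < c \<and> c < d \<and> d < T")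
    case True
    then have "test_function {0<..<T} (bump_pair_primitive (1 / real (Suc n)) a b c d)"
      by (intro test_function_bump_pair_primitive) auto
    then have "AE x in lebesgue_on \<Omega>.
       weak_deriv_against T (\<lambda>t. F t x) (\<lambda>t. G t x) (bump_pair_primitive (1 / real (Suc n)) a b c d)"
      using assms unfolding weak_time_deriv_def weak_deriv_against_def by blast
    then show ?thesis by (rule AE_mp) auto
  qed auto
  then show ?thesis by (simp add: AE_ball_countable[OF countable_rat] AE_all_countable)
qed

lemma AE_integrable_bump_scaled:
  fixes F G :: "real \<Rightarrow> real ^ 3 \<Rightarrow> 'a::euclidean_space"
  assumes "weak_time_deriv T \<Omega> F G"
  shows "AE x in lebesgue_on \<Omega>. \<forall>a\<in>\<rat>. \<forall>b\<in>\<rat>. 0 < a \<and> a < b \<and> b < T \<longrightarrow>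
       integrable (lebesgue_on {0..T}) (\<lambda>t. bump 1 a b t *\<^sub>R G t x)"
proof -
  have "AE x in lebesgue_on \<Omega>. 0 < a \<and> a < b \<and> b < T \<longrightarrow>
       integrable (lebesgue_on {0..T}) (\<lambda>t. bump 1 a b t *\<^sub>R G t x)" for a b
  proof (cases "0 < a \<and> a < b \<and> b < T")
    case True
    then have "test_function {0<..<T} (bump 1 a b)"
      by (intro test_function_bump) auto
    then have "AE x in lebesgue_on \<Omega>. integrable (lebesgue_on {0..T}) (\<lambda>t. bump 1 a b t *\<^sub>R G t x)"
      using assms unfolding weak_time_deriv_def by (force elim: AE_mp)
    then show ?thesis by (rule AE_mp) auto
  qed auto
  then show ?thesis by (simp add: AE_ball_countable[OF countable_rat])
qed

lemma time_space_interpolation: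
  fixes F Ft Ftt :: "real \<Rightarrow> real ^ 3 \<Rightarrow> 'a::euclidean_space"
  assumes T: "T > 0" and \<Omega>: "\<Omega> \<in> sets lebesgue"
    and FFt: "weak_time_deriv T \<Omega> F Ft" and FtFtt: "weak_time_deriv T \<Omega> Ft Ftt"
    and trace: "initial_trace T \<Omega> Ft"
    and init: "in_Lp 3 (lebesgue_on \<Omega>) (Ft 0)"
    and F: "in_Linf_Lp 6 T \<Omega> F" and Ftt: "in_Linf_Lp 2 T \<Omega> Ftt"
    and l: "l > 0"
  shows "(\<integral>\<^sup>+z. ennreal (norm (case_prod Ft z) powr 3) \<partial>cylinder T \<Omega>)
     \<le> ennreal (8 * T * (\<integral>x. norm (Ft 0 x) powr 3 \<partial>lebesgue_on \<Omega>)
         + 2 ^ 9 * (T * Linf_Lp_norm 6 T \<Omega> F ^ 6 / l ^ 3 + l * (T * Linf_Lp_norm 2 T \<Omega> Ftt ^ 2)))"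
proof -
  let ?M = "lebesgue_on {0..T}" and ?N = "lebesgue_on \<Omega>"
  let ?k6 = "Linf_Lp_norm 6 T \<Omega> F" and ?k2 = "Linf_Lp_norm 2 T \<Omega> Ftt"
  interpret M: sigma_finite_measure ?M by (rule sigma_finite_lebesgue_on) auto
  interpret N: sigma_finite_measure ?N by (rule sigma_finite_lebesgue_on[OF \<Omega>])
  interpret MN: pair_sigma_finite ?M ?N ..
  have mF [measurable]: "case_prod F \<in> borel_measurable (?M \<Otimes>\<^sub>M ?N)"
    and mFt [measurable]: "case_prod Ft \<in> borel_measurable (?M \<Otimes>\<^sub>M ?N)"
    and mFtt [measurable]: "case_prod Ftt \<in> borel_measurable (?M \<Otimes>\<^sub>M ?N)"
    using FFt FtFtt by (auto simp: weak_time_deriv_def)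
  define a where "a x = (\<integral>\<^sup>+t. ennreal (norm (F t x) ^ 6) \<partial>?M)" for x
  define b where "b x = (\<integral>\<^sup>+t. ennreal (norm (Ftt t x) ^ 2) \<partial>?M)" for x
  have am [measurable]: "a \<in> borel_measurable ?N" and bm [measurable]: "b \<in> borel_measurable ?N"
    unfolding a_def b_def by measurable
  have a: "(\<integral>\<^sup>+x. a x \<partial>?N) \<le> ennreal (T * ?k6 ^ 6)"
    using iterated_nn_integral_le_Linf_Lp_norm[OF T \<Omega>, of 6 F] F by (simp add: a_def)
  have b: "(\<integral>\<^sup>+x. b x \<partial>?N) \<le> ennreal (T * ?k2 ^ 2)"
    using iterated_nn_integral_le_Linf_Lp_norm[OF T \<Omega>, of 2 Ftt] Ftt by (simp add: b_def)
  have k: "0 \<le> ?k6" "0 \<le> ?k2"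
    using nn_integral_powr_le_Linf_Lp_norm(1)[OF T _ F] nn_integral_powr_le_Linf_Lp_norm(1)[OF T _ Ftt] by auto
  have afin: "AE x in ?N. a x \<noteq> \<infinity>"
    using a by (intro nn_integral_PInf_AE) (auto simp: top_unique)
  have bfin: "AE x in ?N. b x \<noteq> \<infinity>"
    using b by (intro nn_integral_PInf_AE) (auto simp: top_unique)
  have lin: "ennreal (A * x + (B * y + C * z)) = ennreal A * ennreal x + (ennreal B * ennreal y + ennreal C * ennreal z)"
    if "0 \<le> A" "0 \<le> x" "0 \<le> B" "0 \<le> y" "0 \<le> C" "0 \<le> z" for A B C x y z :: real
    using that by (simp add: ennreal_mult)
  \<comment> \<open>Stated in extended nonnegative reals, so that it can be integrated over \<open>\<Omega>\<close> before any
    integrability is known.\<close>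
  have slice: "AE x in ?N. (\<integral>\<^sup>+t. ennreal (norm (Ft t x) ^ 3) \<partial>?M)
      \<le> ennreal (8 * T) * ennreal (norm (Ft 0 x) ^ 3) + (ennreal (2 ^ 9 / l ^ 3) * a x + ennreal (2 ^ 9 * l) * b x)"
    using AE_space afin bfin AE_weak_deriv_against_all[OF FFt] AE_weak_deriv_against_all[OF FtFtt]
      AE_integrable_bump_scaled[OF FFt] trace[unfolded initial_trace_def]
  proof eventually_elim
    case (elim x)
    have [measurable]: "(\<lambda>t. F t x) \<in> borel_measurable ?M" "(\<lambda>t. Ft t x) \<in> borel_measurable ?M"
      "(\<lambda>t. Ftt t x) \<in> borel_measurable ?M"
      using measurable_Pair1[OF mF elim(1)] measurable_Pair1[OF mFt elim(1)] measurable_Pair1[OF mFtt elim(1)] by simp_all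
    obtain g where g: "AE t in ?M. g t = Ft t x" "(g \<longlongrightarrow> Ft 0 x) (at_right 0)" using elim(7) by blast
    have i6: "integrable ?M (\<lambda>t. norm (F t x) ^ 6)"
      using elim(2) by (intro integrableI_nonneg) (auto simp: a_def top.not_eq_extremum)
    have i2: "integrable ?M (\<lambda>t. norm (Ftt t x) ^ 2)"
      using elim(3) by (intro integrableI_nonneg) (auto simp: b_def top.not_eq_extremum)
    have ax: "a x = ennreal (\<integral>t. norm (F t x) ^ 6 \<partial>?M)"
      unfolding a_def by (rule nn_integral_eq_integral[OF i6]) simp
    have bx: "b x = ennreal (\<integral>t. norm (Ftt t x) ^ 2 \<partial>?M)"
      unfolding b_def by (rule nn_integral_eq_integral[OF i2]) simp
    note S = slice_interpolation[OF T _ _ _ i6 i2 _ _ g l]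
    have i3: "integrable ?M (\<lambda>t. norm (Ft t x) ^ 3)"
      by (rule S(1)) (use elim(4,5,6) in auto)
    have "(\<integral>t. norm (Ft t x) ^ 3 \<partial>?M) \<le> 8 * T * norm (Ft 0 x) ^ 3
        + 2 ^ 9 * ((\<integral>t. norm (F t x) ^ 6 \<partial>?M) / l ^ 3 + l * (\<integral>t. norm (Ftt t x) ^ 2 \<partial>?M))"
      by (rule S(2)) (use elim(4,5,6) in auto)
    then have "(\<integral>\<^sup>+t. ennreal (norm (Ft t x) ^ 3) \<partial>?M) \<le> ennreal (8 * T * norm (Ft 0 x) ^ 3
        + (2 ^ 9 / l ^ 3 * (\<integral>t. norm (F t x) ^ 6 \<partial>?M) + 2 ^ 9 * l * (\<integral>t. norm (Ftt t x) ^ 2 \<partial>?M)))"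
      by (subst nn_integral_eq_integral[OF i3]) (auto intro!: ennreal_leI simp: algebra_simps)
    also have "\<dots> = ennreal (8 * T) * ennreal (norm (Ft 0 x) ^ 3) + (ennreal (2 ^ 9 / l ^ 3) * a x + ennreal (2 ^ 9 * l) * b x)"
      unfolding ax bx using T l by (intro lin) auto
    finally show ?case .
  qed
  have m0 [measurable]: "Ft 0 \<in> borel_measurable ?N" using init by (simp add: in_Lp_def)
  have "(\<integral>\<^sup>+z. ennreal (norm (case_prod Ft z) powr 3) \<partial>cylinder T \<Omega>)
      = (\<integral>\<^sup>+x. \<integral>\<^sup>+t. ennreal (norm (Ft t x) ^ 3) \<partial>?M \<partial>?N)"
    using MN.nn_integral_snd[of "\<lambda>z. ennreal (norm (case_prod Ft z) powr 3)"] by simp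
  also have "\<dots> \<le> (\<integral>\<^sup>+x. ennreal (8 * T) * ennreal (norm (Ft 0 x) ^ 3)
        + (ennreal (2 ^ 9 / l ^ 3) * a x + ennreal (2 ^ 9 * l) * b x) \<partial>?N)"
    by (rule nn_integral_mono_AE[OF slice])
  also have "\<dots> = ennreal (8 * T) * (\<integral>\<^sup>+x. ennreal (norm (Ft 0 x) ^ 3) \<partial>?N)
        + (ennreal (2 ^ 9 / l ^ 3) * (\<integral>\<^sup>+x. a x \<partial>?N) + ennreal (2 ^ 9 * l) * (\<integral>\<^sup>+x. b x \<partial>?N))"
    by (simp add: nn_integral_add nn_integral_cmult)
  also have "(\<integral>\<^sup>+x. ennreal (norm (Ft 0 x) ^ 3) \<partial>?N) = ennreal (\<integral>x. norm (Ft 0 x) powr 3 \<partial>?N)"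
    using init by (subst nn_integral_eq_integral) (auto simp: in_Lp_def)
  also have "ennreal (8 * T) * ennreal (\<integral>x. norm (Ft 0 x) powr 3 \<partial>?N)
        + (ennreal (2 ^ 9 / l ^ 3) * (\<integral>\<^sup>+x. a x \<partial>?N) + ennreal (2 ^ 9 * l) * (\<integral>\<^sup>+x. b x \<partial>?N))
     \<le> ennreal (8 * T) * ennreal (\<integral>x. norm (Ft 0 x) powr 3 \<partial>?N)
        + (ennreal (2 ^ 9 / l ^ 3) * ennreal (T * ?k6 ^ 6) + ennreal (2 ^ 9 * l) * ennreal (T * ?k2 ^ 2))"
    by (intro add_left_mono add_mono mult_left_mono a b) auto
  also have "\<dots> = ennreal (8 * T * (\<integral>x. norm (Ft 0 x) powr 3 \<partial>?N)
        + (2 ^ 9 / l ^ 3 * (T * ?k6 ^ 6) + 2 ^ 9 * l * (T * ?k2 ^ 2)))"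
    using T l k by (intro lin[symmetric]) auto
  also have "8 * T * (\<integral>x. norm (Ft 0 x) powr 3 \<partial>?N) + (2 ^ 9 / l ^ 3 * (T * ?k6 ^ 6) + 2 ^ 9 * l * (T * ?k2 ^ 2))
     = 8 * T * (\<integral>x. norm (Ft 0 x) powr 3 \<partial>?N)
         + 2 ^ 9 * (T * ?k6 ^ 6 / l ^ 3 + l * (T * ?k2 ^ 2))"
    by (simp add: algebra_simps)
  finally show ?thesis .
qed

section \<open>The estimate\<close>

text \<open>
  The best weight is \<open>l = k^(3/2) / h^(1/2)\<close>, up to a constant. It is replaced by \<open>p^3 / q\<close> with
  \<open>p = sqrt (k + e)\<close> and \<open>q = sqrt (h + e)\<close>, because \<open>k\<close> or \<open>h\<close> may vanish.
\<close>

lemma le_optimal_weight: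
  fixes S c k h :: real
  assumes le: "\<And>l. l > 0 \<Longrightarrow> S \<le> c + k ^ 6 / l ^ 3 + l * h ^ 2" and k: "0 \<le> k" and h: "0 \<le> h"
  shows "S \<le> c + 2 * sqrt (k * h) ^ 3"
proof -
  have "S \<le> c + 2 * sqrt ((k + e) * (h + e)) ^ 3" if e: "e > 0" for e
  proof -
    define p q where "p = sqrt (k + e)" and "q = sqrt (h + e)"
    have pq: "p > 0" "q > 0" "p ^ 2 = k + e" "q ^ 2 = h + e" using k h e by (auto simp: p_def q_def)
    have "S \<le> c + k ^ 6 / (p ^ 3 / q) ^ 3 + p ^ 3 / q * h ^ 2" using pq by (intro le) auto
    also have "\<dots> \<le> c + (p ^ 2) ^ 6 / (p ^ 3 / q) ^ 3 + p ^ 3 / q * (q ^ 2) ^ 2"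
      unfolding pq(3,4) using pq(1,2) k h e
      by (intro add_mono divide_right_mono mult_left_mono power_mono order_refl) auto
    also have "\<dots> = c + 2 * (p * q) ^ 3"
      using pq(1,2) by (simp add: field_simps eval_nat_numeral)
    finally show ?thesis by (simp add: p_def q_def real_sqrt_mult)
  qed
  from le_at_0_if_le_right[of "\<lambda>e. c + 2 * sqrt ((k + e) * (h + e)) ^ 3" S, OF _ this]
  show ?thesis by (simp add: continuous_intros)
qed

text \<open>
  Superadditivity of the cube lets one take the cube root of the sum termwise. The constant comes from
  \<open>2^10 \<le> 16^3\<close> and \<open>(16 (p + r))^2 \<le> 512 (p^2 + r^2)\<close>.
\<close>

lemma power_mean_bound:
  fixes S T c k h :: real
  assumes S: "0 \<le> S" "S \<le> 2 ^ 10 * T * (c + sqrt (k * h) ^ 3)"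
    and nn: "0 \<le> T" "0 \<le> c" "0 \<le> k" "0 \<le> h"
  shows "(S powr (1 / 3)) ^ 2 \<le> 512 * T powr (2 / 3) * ((c powr (1 / 3)) ^ 2 + k * h)"
proof -
  define p r \<tau> where "p = c powr (1 / 3)" and "r = sqrt (k * h)" and "\<tau> = T powr (1 / 3)"
  have nn': "0 \<le> p" "0 \<le> r" "0 \<le> \<tau>" using nn by (auto simp: p_def r_def \<tau>_def)
  have cube: "(y powr (1 / 3)) ^ 3 = y" if "0 \<le> y" for y :: real
    using that by (simp flip: powr_numeral add: powr_powr)
  have \<tau>2: "T powr (2 / 3) = \<tau> ^ 2" by (simp add: \<tau>_def power2_eq_square flip: powr_add)
  have "(S powr (1 / 3)) ^ 3 \<le> (16 * \<tau> * (p + r)) ^ 3"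
  proof -
    have "S \<le> 2 ^ 10 * \<tau> ^ 3 * (p ^ 3 + r ^ 3)" using S(2) nn by (simp add: p_def \<tau>_def r_def cube)
    also have "\<dots> \<le> 16 ^ 3 * \<tau> ^ 3 * (p + r) ^ 3"
    proof (intro mult_mono)
      show "p ^ 3 + r ^ 3 \<le> (p + r) ^ 3" using nn' by (simp add: power3_eq_cube algebra_simps)
    qed (use nn' in auto)
    finally show ?thesis using S(1) by (simp add: cube power_mult_distrib)
  qed
  then have "S powr (1 / 3) \<le> 16 * \<tau> * (p + r)" by (rule power_le_imp_le_base[where n = 2, unfolded Suc_numeral, simplified]) (use nn' in auto)
  then have "(S powr (1 / 3)) ^ 2 \<le> (16 * \<tau> * (p + r)) ^ 2" by (intro power_mono) auto
  also have "\<dots> = 256 * \<tau> ^ 2 * (p + r) ^ 2" by (simp add: power_mult_distrib)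
  also have "\<dots> \<le> 256 * \<tau> ^ 2 * (2 * (p ^ 2 + r ^ 2))"
    using sum_squares_bound[of p r] by (intro mult_left_mono) (auto simp: power2_sum)
  also have "r ^ 2 = k * h" using nn by (simp add: r_def)
  finally show ?thesis by (simp add: \<tau>2 p_def algebra_simps)
qed

theorem proposition2p1:
  shows "\<exists>C::real. \<forall>(T::real) (\<Omega>::(real ^ 3) set)
           (F :: real \<Rightarrow> real ^ 3 \<Rightarrow> 'a::euclidean_space) F\<^sub>t F\<^sub>t\<^sub>t.
         T > 0 \<longrightarrow> \<Omega> \<in> sets lebesgue \<longrightarrow>
         weak_time_deriv T \<Omega> F F\<^sub>t \<longrightarrow>
         weak_time_deriv T \<Omega> F\<^sub>t F\<^sub>t\<^sub>t \<longrightarrow>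
         initial_trace T \<Omega> F\<^sub>t \<longrightarrow>
         in_Lp 3 (lebesgue_on \<Omega>) (F\<^sub>t 0) \<longrightarrow>
         in_Linf_Lp 6 T \<Omega> F \<longrightarrow>
         in_Linf_Lp 2 T \<Omega> F\<^sub>t\<^sub>t \<longrightarrow>
         in_Lp 3 (cylinder T \<Omega>) (case_prod F\<^sub>t) \<and>
         (Lp_norm 3 (cylinder T \<Omega>) (case_prod F\<^sub>t))\<^sup>2
           \<le> C * T powr (2 / 3) *
              ((Lp_norm 3 (lebesgue_on \<Omega>) (F\<^sub>t 0))\<^sup>2
               + Linf_Lp_norm 6 T \<Omega> F * Linf_Lp_norm 2 T \<Omega> F\<^sub>t\<^sub>t)"
proof (intro exI[of _ 512] allI impI)
  fix T \<Omega> and F Ft Ftt :: "real \<Rightarrow> real ^ 3 \<Rightarrow> 'a"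
  assume T: "T > 0" and \<Omega>: "\<Omega> \<in> sets lebesgue"
    and FFt: "weak_time_deriv T \<Omega> F Ft" and FtFtt: "weak_time_deriv T \<Omega> Ft Ftt"
    and trace: "initial_trace T \<Omega> Ft" and init: "in_Lp 3 (lebesgue_on \<Omega>) (Ft 0)"
    and F: "in_Linf_Lp 6 T \<Omega> F" and Ftt: "in_Linf_Lp 2 T \<Omega> Ftt"
  define c where "c = (\<integral>x. norm (Ft 0 x) powr 3 \<partial>lebesgue_on \<Omega>)"
  define k where "k = Linf_Lp_norm 6 T \<Omega> F"
  define h where "h = Linf_Lp_norm 2 T \<Omega> Ftt"
  define S where "S = (\<integral>z. norm (case_prod Ft z) powr 3 \<partial>cylinder T \<Omega>)"
  have nn: "0 \<le> c" "0 \<le> k" "0 \<le> h" "0 \<le> S"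
    using nn_integral_powr_le_Linf_Lp_norm(1)[OF T _ F] nn_integral_powr_le_Linf_Lp_norm(1)[OF T _ Ftt]
    by (auto simp: c_def k_def h_def S_def)
  note bound = time_space_interpolation[OF T \<Omega> FFt FtFtt trace init F Ftt, folded c_def k_def h_def]
  have meas: "case_prod Ft \<in> borel_measurable (cylinder T \<Omega>)" using FFt by (simp add: weak_time_deriv_def)
  have int: "integrable (cylinder T \<Omega>) (\<lambda>z. norm (case_prod Ft z) powr 3)"
    using bound[OF zero_less_one] meas
    by (intro integrableI_nonneg) (auto intro: order.strict_trans1)
  have "S \<le> 8 * T * c + 2 ^ 9 * (T * k ^ 6 / l ^ 3 + l * (T * h ^ 2))" if "l > 0" for l
  proof -
    have "ennreal S \<le> ennreal (8 * T * c + 2 ^ 9 * (T * k ^ 6 / l ^ 3 + l * (T * h ^ 2)))"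
      using bound[OF that] unfolding S_def by (subst nn_integral_eq_integral[OF int, symmetric]) auto
    then show ?thesis using T that nn by (subst (asm) ennreal_le_iff) auto
  qed
  then have "S / (2 ^ 9 * T) \<le> 8 * c / 2 ^ 9 + k ^ 6 / l ^ 3 + l * h ^ 2" if "l > 0" for l
    using divide_right_mono[of S _ "2 ^ 9 * T"] that T by (fastforce simp: field_simps)
  from le_optimal_weight[OF this nn(2,3)]
  have "S / (2 ^ 9 * T) \<le> 8 * c / 2 ^ 9 + 2 * sqrt (k * h) ^ 3" .
  then have "S \<le> 8 * T * c + 2 ^ 10 * T * sqrt (k * h) ^ 3" using T by (simp add: field_simps)
  also have "\<dots> \<le> 2 ^ 10 * T * (c + sqrt (k * h) ^ 3)" using T nn by (simp add: algebra_simps)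
  finally have "(S powr (1 / 3)) ^ 2 \<le> 512 * T powr (2 / 3) * ((c powr (1 / 3)) ^ 2 + k * h)"
    using T nn by (intro power_mean_bound) auto
  then show "in_Lp 3 (cylinder T \<Omega>) (case_prod Ft) \<and>
     (Lp_norm 3 (cylinder T \<Omega>) (case_prod Ft))\<^sup>2
       \<le> 512 * T powr (2 / 3) * ((Lp_norm 3 (lebesgue_on \<Omega>) (Ft 0))\<^sup>2
               + Linf_Lp_norm 6 T \<Omega> F * Linf_Lp_norm 2 T \<Omega> Ftt)"
    using int meas by (simp add: in_Lp_def Lp_norm_def S_def c_def k_def h_def)
qed

end
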